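(* Let $n\ge3$, $d\ge2$, and let $V$ be a matrix weight with $|V|\in\mathrm{B}_p$ for some $p>\frac n2$. Then there is a constant $C$, depending only on $d,n,p,C_{|V|}$, such that for every compactly supported $C^1$ function $\vec u:\mathbb{R}^n\to\mathbb{R}^d$, $$\int_{\mathbb{R}^n}|m(x,|V|)\,\vec u(x)|^2\,dx\le C\left(\int_{\mathbb{R}^n}|D\vec u(x)|^2\,dx+\int_{\mathbb{R}^n}|V(x)|\,|\vec u(x)|^2\,dx\right).$$
   Context: A matrix weight is a $d\times d$ real symmetric positive semidefinite measurable matrix function on $\mathbb{R}^n$; $|V(x)|$ is its operator norm (largest eigenvalue). A nonnegative scalar function $v$ belongs to the reverse Hölder class $\mathrm{B}_p$ if $v\in L^p_{loc}(\mathbb{R}^n)$ and there is a constant $C_v$ with $\big(\frac1{|Q|}\int_Qv^p\big)^{1/p}\le C_v\frac1{|Q|}\int_Qv$ for all (axis-parallel) cubes $Q$. For scalar $v\in\mathrm{B}_p$, $p>\frac n2$ (not a.e. zero), the auxiliary function $m(x,v)\in(0,\infty)$ is defined by $\frac1{m(x,v)}=\sup\{r>0:r^{2-n}\int_{Q(x,r)}v(y)\,dy\le1\}$, where $Q(x,r)$ is the cube with center $x$ and side length $2r$. *)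

theory Defs
  imports "HOL-Analysis.Analysis"
begin

definition matrix_weight :: "(real^'n \<Rightarrow> real^'d^'d) \<Rightarrow> bool" where
  "matrix_weight V \<longleftrightarrow>
     V \<in> borel_measurable lebesgue \<and>
     (\<forall>x. transpose (V x) = V x \<and> (\<forall>w. 0 \<le> w \<bullet> (V x *v w)))"

definition op_norm :: "real^'d^'d \<Rightarrow> real" where
  "op_norm A = onorm (\<lambda>w. A *v w)"

text \<open>Here \<open>r\<close> is half the side length.\<close>

definition cube :: "real^'n \<Rightarrow> real \<Rightarrow> (real^'n) set" where
  "cube x r = {y. \<forall>i. \<bar>y $ i - x $ i\<bar> \<le> r}"

definition Lp_loc :: "real \<Rightarrow> (real^'n \<Rightarrow> real) \<Rightarrow> bool" where
  "Lp_loc p v \<longleftrightarrow>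
     v \<in> borel_measurable lebesgue \<and>
     (\<forall>S. compact S \<longrightarrow> set_integrable lebesgue S (\<lambda>x. \<bar>v x\<bar> powr p))"

text \<open>\<open>K\<close> is any admissible constant in the reverse Hoelder inequality, not necessarily the
  least one.\<close>

definition reverse_hoelder :: "real \<Rightarrow> real \<Rightarrow> (real^'n \<Rightarrow> real) \<Rightarrow> bool" where
  "reverse_hoelder p K v \<longleftrightarrow>
     (\<forall>x. 0 \<le> v x) \<and> Lp_loc p v \<and>
     (\<forall>x r. 0 < r \<longrightarrow>
        ((LINT y:cube x r|lebesgue. v y powr p) / measure lebesgue (cube x r)) powr (1 / p)
          \<le> K * ((LINT y:cube x r|lebesgue. v y) / measure lebesgue (cube x r)))"

text \<open>The auxiliary function \<open>m(x, v)\<close>. It is extended-valued only to make it total: the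
  supremum is infinite, and so \<open>aux_m v x = 0\<close>, when \<open>v\<close> vanishes almost everywhere.\<close>

definition aux_m :: "(real^'n \<Rightarrow> real) \<Rightarrow> real^'n \<Rightarrow> ennreal" where
  "aux_m v x =
     inverse (SUP r \<in> {r::real. 0 < r \<and>
        ennreal (r powi (2 - int CARD('n))) * (\<integral>\<^sup>+y\<in>cube x r. ennreal (v y) \<partial>lebesgue) \<le> 1}.
        ennreal r)"

definition C1_compact_support :: "(real^'n \<Rightarrow> real^'d) \<Rightarrow> bool" where
  "C1_compact_support u \<longleftrightarrow>
     (\<forall>x. u differentiable (at x)) \<and>
     continuous_on UNIV (\<lambda>x. jacobian u (at x)) \<and>
     compact (closure {x. u x \<noteq> 0})"

end

theory Submission
  imports Defs
begin

text \<open>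
  Write \<open>v = \<bar>V\<bar>\<close> and \<open>\<Phi>(x, r) = r\<^sup>2\<^sup>-\<^sup>n \<integral>v\<close>, the integral being over the cube \<open>cube x r\<close>; this is
  \<open>scaled_mass\<close> below. The theorem is a Fefferman-Phong inequality
  for the scalar reverse Hoelder weight \<open>v\<close> (\<open>fefferman_phong_reverse_hoelder\<close>).

  The reverse Hoelder inequality forbids concentration: a set that fills a small fraction of a cube
  carries a small fraction of the mass of \<open>v\<close> (\<open>mass_subset_le\<close>). This has three consequences.
  The mass is doubling (\<open>mass_doubling\<close>). Going down from scale \<open>r\<close> to \<open>s r\<close>, \<open>\<Phi>\<close> decreases at least
  like \<open>s\<close> to the power \<open>2 - n/p\<close>, which is positive because \<open>p > n/2\<close> (\<open>scaled_mass_decay\<close>).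
  And \<open>v\<close> is at least a quarter of its average on a fixed fraction of every cube
  (\<open>reverse_hoelder_large_values\<close>).

  If \<open>v\<close> has positive mass somewhere, decay and doubling show that along the dyadic cells containing a
  point, \<open>\<Phi>\<close> tends to \<open>0\<close> at small scales and to infinity at large ones, so there is a largest cell
  with \<open>\<Phi> \<le> 1\<close> (\<open>stopping_level_exists\<close>). These stopped cells tile the space. On a stopped cell of
  size \<open>h\<close>, two things are true up to constants: \<open>m(x, v) \<le> 1/h\<close>, since \<open>\<Phi>(x, s h) \<le> 1\<close> for a fixed
  small \<open>s\<close> (\<open>aux_m_le_stopped\<close>); and \<open>v \<ge> 1/h\<^sup>2\<close> on a fixed fraction of the cell, because the parent
  cell has \<open>\<Phi> > 1\<close>. On that fraction \<open>\<bar>u\<bar>\<^sup>2/h\<^sup>2\<close> is controlled by \<open>v \<bar>u\<bar>\<^sup>2\<close>, and a Poincare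
  inequality transports this bound to the rest of the cell at the price of \<open>\<bar>Du\<bar>\<^sup>2\<close>
  (\<open>local_energy_bound\<close>). Adding up over the disjoint stopped cells gives the theorem.
\<close>

section \<open>Cubes and the mass of a reverse Hoelder weight\<close>

lemma cube_eq_cbox: "cube x r = cbox (x - (\<chi> i. r)) (x + (\<chi> i. r))"
proof -
  have "\<bar>a - b\<bar> \<le> r \<longleftrightarrow> b - r \<le> a \<and> a \<le> b + r" for a b :: real by linarith
  then show ?thesis by (auto simp: cube_def mem_box_cart)
qed

lemma cube_lmeasurable [simp]: "cube x r \<in> lmeasurable"
  by (simp add: cube_eq_cbox)

lemma cube_sets_lebesgue [simp]: "cube x r \<in> sets lebesgue"
  by (simp add: cube_eq_cbox)

lemma cube_sets_borel [measurable]: "cube x r \<in> sets borel"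
  by (simp add: cube_eq_cbox)

lemma measure_cube:
  fixes x :: "real^'n"
  assumes "0 \<le> r"
  shows "measure lborel (cube x r) = (2 * r) ^ CARD('n)"
    and "measure lebesgue (cube x r) = (2 * r) ^ CARD('n)"
proof -
  show "measure lborel (cube x r) = (2 * r) ^ CARD('n)"
    unfolding cube_eq_cbox using assms
    by (subst content_cbox_cart) (auto simp: interval_eq_empty_cart)
  then show "measure lebesgue (cube x r) = (2 * r) ^ CARD('n)"
    by (simp add: cube_sets_borel)
qed

lemma cube_mono_center: "(\<And>i. \<bar>x $ i - y $ i\<bar> \<le> s - r) \<Longrightarrow> cube x r \<subseteq> cube y s"
proof (clarsimp simp: cube_def)
  fix z i assume a: "\<And>i. \<bar>x $ i - y $ i\<bar> \<le> s - r" "\<forall>i. \<bar>z $ i - x $ i\<bar> \<le> r"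
  from a(1)[of i] a(2)[rule_format, of i] show "\<bar>z $ i - y $ i\<bar> \<le> s" by linarith
qed

lemma cube_mono: "r \<le> s \<Longrightarrow> cube x r \<subseteq> cube x s"
  by (rule cube_mono_center) simp

lemma reverse_hoelder_nonneg: "reverse_hoelder p K v \<Longrightarrow> 0 \<le> v x"
  by (simp add: reverse_hoelder_def)

lemma reverse_hoelder_measurable: "reverse_hoelder p K v \<Longrightarrow> v \<in> borel_measurable lebesgue"
  by (simp add: reverse_hoelder_def Lp_loc_def)

lemma reverse_hoelder_powr_integrable:
  assumes "reverse_hoelder p K v"
  shows "set_integrable lebesgue (cube x r) (\<lambda>y. v y powr p)"
  using assms unfolding reverse_hoelder_def Lp_loc_def
  by (metis (no_types, lifting) abs_of_nonneg cube_eq_cbox compact_cbox set_integrable_cong)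

text \<open>
  Splitting a function at the height \<open>l\<close>: below it the first term suffices, above it the second.
  With a good choice of \<open>l\<close> this replaces Hoelder's inequality at the cost of a factor 2.
\<close>

lemma height_split:
  fixes a l p :: real
  assumes "0 \<le> a" "0 < l" "1 \<le> p"
  shows "a \<le> l + l powr (1 - p) * a powr p"
proof (cases "a \<le> l")
  case False
  then have "a = a powr (1 - p) * a powr p" using assms by (simp add: powr_add [symmetric])
  also have "\<dots> \<le> l powr (1 - p) * a powr p"
    using False assms by (intro mult_right_mono powr_mono2') auto
  finally show ?thesis using assms by simp
qed (use assms in \<open>auto intro: add_increasing2\<close>)

lemma reverse_hoelder_integrable:
  assumes v: "reverse_hoelder p K v" and p: "1 \<le> p"
    and E: "E \<in> sets lebesgue" "E \<subseteq> cube x r"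
  shows "set_integrable lebesgue E v"
proof -
  have "set_integrable lebesgue (cube x r) (\<lambda>y. 1 + v y powr p)"
    by (intro set_integral_add(1) reverse_hoelder_powr_integrable [OF v])
       (simp add: set_integrable_def lmeasurable_iff_integrable [symmetric])
  then have "set_integrable lebesgue (cube x r) v"
    unfolding set_integrable_def
  proof (rule Bochner_Integration.integrable_bound)
    have [measurable]: "cube x r \<in> sets lebesgue" "v \<in> borel_measurable lebesgue"
      by (simp_all add: reverse_hoelder_measurable [OF v])
    show "(\<lambda>y. indicat_real (cube x r) y *\<^sub>R v y) \<in> borel_measurable lebesgue"
      by measurable
  qed (use reverse_hoelder_nonneg [OF v] height_split[of _ 1 p] p in \<open>auto simp: indicator_def\<close>)
  then show ?thesis using E by (rule set_integrable_subset)
qed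

lemma mass_nonneg: "reverse_hoelder p K v \<Longrightarrow> 0 \<le> (LINT y:E|lebesgue. v y)"
  unfolding set_lebesgue_integral_def
  by (intro Bochner_Integration.integral_nonneg) (simp add: reverse_hoelder_nonneg)

lemma mass_mono:
  assumes v: "reverse_hoelder p K v" and p: "1 \<le> p"
    and "A \<subseteq> B" "B \<subseteq> cube x r" and A: "A \<in> sets lebesgue" "B \<in> sets lebesgue"
  shows "(LINT y:A|lebesgue. v y) \<le> (LINT y:B|lebesgue. v y)"
  unfolding set_lebesgue_integral_def
proof (rule integral_mono)
  show "integrable lebesgue (\<lambda>y. indicat_real A y *\<^sub>R v y)"
    "integrable lebesgue (\<lambda>y. indicat_real B y *\<^sub>R v y)"
    using reverse_hoelder_integrable[OF v p, of _ x r] assms unfolding set_integrable_def by auto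
  show "indicat_real A y *\<^sub>R v y \<le> indicat_real B y *\<^sub>R v y" for y
    using assms reverse_hoelder_nonneg[OF v, of y] by (auto simp: indicator_def)
qed

lemma mass_mono_cube:
  assumes "reverse_hoelder p K v" "1 \<le> p" "\<And>i. \<bar>x $ i - y $ i\<bar> \<le> s - r"
  shows "(LINT z:cube x r|lebesgue. v z) \<le> (LINT z:cube y s|lebesgue. v z)"
  using assms by (intro mass_mono[OF assms(1,2) _ order_refl] cube_mono_center) auto

lemma mass_eq_nn_integral:
  assumes v: "reverse_hoelder p K v" and p: "1 \<le> p"
  shows "(\<integral>\<^sup>+y\<in>cube x r. ennreal (v y) \<partial>lebesgue) = ennreal (LINT y:cube x r|lebesgue. v y)"
proof -
  have "integrable lebesgue (\<lambda>y. indicat_real (cube x r) y *\<^sub>R v y)"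
    using reverse_hoelder_integrable[OF v p cube_sets_lebesgue order_refl]
    by (simp add: set_integrable_def)
  from nn_integral_eq_integral[OF this]
  have "(\<integral>\<^sup>+y. ennreal (indicat_real (cube x r) y *\<^sub>R v y) \<partial>lebesgue)
      = ennreal (LINT y:cube x r|lebesgue. v y)"
    by (simp add: reverse_hoelder_nonneg[OF v] set_lebesgue_integral_def)
  moreover have "ennreal (v y) * indicator (cube x r) y
      = ennreal (indicat_real (cube x r) y *\<^sub>R v y)" for y
    by (auto simp: indicator_def)
  ultimately show ?thesis by simp
qed

lemma reverse_hoelder_powr_mass:
  assumes v: "reverse_hoelder p K v" and p: "1 < p" and K: "0 \<le> K" and r: "0 < r"
  shows "(LINT y:cube x r|lebesgue. v y powr p)
    \<le> (K * ((LINT y:cube x r|lebesgue. v y) / measure lebesgue (cube x r))) powr p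
        * measure lebesgue (cube x r)"
proof -
  let ?m = "measure lebesgue (cube x r)" and ?P = "LINT y:cube x r|lebesgue. v y powr p"
  have m: "?m > 0" using r by (simp add: measure_cube)
  have P: "?P \<ge> 0" unfolding set_lebesgue_integral_def
    by (intro Bochner_Integration.integral_nonneg) simp
  have "(?P / ?m) powr (1/p) \<le> K * ((LINT y:cube x r|lebesgue. v y) / ?m)"
    using v r by (simp add: reverse_hoelder_def)
  then have "((?P / ?m) powr (1/p)) powr p \<le> (K * ((LINT y:cube x r|lebesgue. v y) / ?m)) powr p"
    using p by (intro powr_mono2) auto
  moreover have "((?P / ?m) powr (1/p)) powr p = ?P / ?m"
    using p m P by (simp add: powr_powr)
  ultimately show ?thesis using m by (simp add: field_simps)
qed

text \<open>
  With \<open>A = K\<close> times the average of \<open>v\<close>, the reverse Hoelder inequality bounds the average of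
  \<open>v powr p\<close> by \<open>A powr p\<close>. Splitting \<open>v\<close> at the height \<open>l = A * s powr (- 1/p)\<close> balances the two
  contributions to the mass of \<open>E\<close>: their bounds agree.
\<close>

lemma mass_subset_le:
  fixes x :: "real^'n"
  assumes v: "reverse_hoelder p K v" and p: "1 < p" and K: "1 \<le> K" and r: "0 < r"
    and E: "E \<in> sets lebesgue" "E \<subseteq> cube x r" and s: "0 < s"
    and Es: "measure lebesgue E \<le> s * measure lebesgue (cube x r)"
  shows "(LINT y:E|lebesgue. v y)
    \<le> 2 * K * s powr (1 - 1/p) * (LINT y:cube x r|lebesgue. v y)"
proof -
  let ?m = "measure lebesgue (cube x r)" and ?I = "LINT y:cube x r|lebesgue. v y"
  let ?P = "LINT y:cube x r|lebesgue. v y powr p"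
  have m: "?m > 0" using r by (simp add: measure_cube)
  have I: "?I \<ge> 0" by (rule mass_nonneg[OF v])
  have EI: "(LINT y:E|lebesgue. v y) \<le> ?I"
    using mass_mono[OF v _ E(2) order_refl E(1)] p by simp
  show ?thesis
  proof (cases "?I = 0")
    case True then show ?thesis using EI by simp
  next
    case False
    define A where "A = K * (?I / ?m)"
    have A: "A > 0" unfolding A_def using I False m K by simp
    define l where "l = A * s powr (- 1/p)"
    have l: "l > 0" using A s by (simp add: l_def)
    have Em: "E \<in> lmeasurable"
      using E by (meson cube_lmeasurable fmeasurableI2)
    have vp: "set_integrable lebesgue E (\<lambda>y. v y powr p)"
      by (rule set_integrable_subset[OF reverse_hoelder_powr_integrable[OF v] E])
    have c: "set_integrable lebesgue E (\<lambda>y. l)"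
      using Em by (simp add: set_integrable_def lmeasurable_iff_integrable)
    have "(LINT y:E|lebesgue. v y) \<le> (LINT y:E|lebesgue. l + l powr (1-p) * v y powr p)"
      using p l by (intro set_integral_mono reverse_hoelder_integrable[OF v _ E]
          set_integral_add(1) c set_integrable_mult_right vp height_split reverse_hoelder_nonneg[OF v]) auto
    also have "\<dots> = measure lebesgue E * l + l powr (1-p) * (LINT y:E|lebesgue. v y powr p)"
      using c vp by (subst set_integral_add(2))
        (auto simp: set_lebesgue_integral_def)
    also have "(LINT y:E|lebesgue. v y powr p) \<le> ?P"
      unfolding set_lebesgue_integral_def
      using vp reverse_hoelder_powr_integrable[OF v] E(2) unfolding set_integrable_def
      by (intro integral_mono) (auto simp: indicator_def)
    also have "?P \<le> A powr p * ?m"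
      unfolding A_def using reverse_hoelder_powr_mass[OF v p _ r] K by simp
    also have "measure lebesgue E * l + l powr (1-p) * (A powr p * ?m)
        \<le> s * ?m * l + l powr (1-p) * (A powr p * ?m)"
      using Es l by (simp add: mult_right_mono)
    also have "s * ?m * l = A * ?m * s powr (1 - 1/p)"
      using s by (simp add: l_def powr_diff powr_minus powr_divide field_simps)
    also have "l powr (1-p) * (A powr p * ?m) = A * ?m * s powr (1 - 1/p)"
    proof -
      have "l powr (1-p) = A powr (1-p) * s powr (1 - 1/p)"
        using A s p by (simp add: l_def powr_mult powr_powr) (simp add: diff_divide_distrib)
      moreover have "A powr (1-p) * A powr p = A" using A by (simp add: powr_add[symmetric])
      ultimately show ?thesis by (simp add: mult_ac)
    qed
    also have "A * ?m * s powr (1 - 1/p) + A * ?m * s powr (1 - 1/p) = 2 * K * s powr (1 - 1/p) * ?I"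
      using m by (simp add: A_def)
    finally show ?thesis using l by (auto simp: mult_left_mono)
  qed
qed

section \<open>Doubling, decay and large values\<close>

text \<open>
  The fraction of a cube at which \<open>mass_subset_le\<close> yields exactly half of the mass.
\<close>

definition small_fraction :: "real \<Rightarrow> real \<Rightarrow> real" where
  "small_fraction p K = (1 / (4 * K)) powr (1 / (1 - 1/p))"

lemma small_fraction_bounds:
  assumes "1 < p" "1 \<le> K" shows "0 < small_fraction p K" "small_fraction p K < 1"
proof -
  show "0 < small_fraction p K" using assms by (simp add: small_fraction_def)
  have "(1 / (4 * K)) powr (1 / (1 - 1/p)) < 1 powr (1 / (1 - 1/p))"
    using assms by (intro powr_less_mono2) auto
  then show "small_fraction p K < 1" by (simp add: small_fraction_def)
qed

lemma mass_small_fraction: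
  fixes x :: "real^'n"
  assumes v: "reverse_hoelder p K v" and p: "1 < p" and K: "1 \<le> K" and r: "0 < r"
    and E: "E \<in> sets lebesgue" "E \<subseteq> cube x r"
    and Es: "measure lebesgue E \<le> small_fraction p K * measure lebesgue (cube x r)"
  shows "(LINT y:E|lebesgue. v y) \<le> (LINT y:cube x r|lebesgue. v y) / 2"
proof -
  have "small_fraction p K powr (1 - 1/p) = 1 / (4 * K)"
    using p K by (simp add: small_fraction_def powr_powr)
  with mass_subset_le[OF v p K r E small_fraction_bounds(1)[OF p K] Es]
  show ?thesis using K by simp
qed

lemma mass_add_Diff:
  assumes v: "reverse_hoelder p K v" and p: "1 \<le> p"
    and E: "E \<in> sets lebesgue" "E \<subseteq> cube x r"
  shows "(LINT y:cube x r|lebesgue. v y)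
    = (LINT y:E|lebesgue. v y) + (LINT y:cube x r - E|lebesgue. v y)"
proof -
  have "cube x r = E \<union> (cube x r - E)" using E by auto
  then have "(LINT y:cube x r|lebesgue. v y) = (LINT y:E \<union> (cube x r - E)|lebesgue. v y)" by simp
  also have "\<dots> = (LINT y:E|lebesgue. v y) + (LINT y:cube x r - E|lebesgue. v y)"
    using E by (intro set_integral_Un reverse_hoelder_integrable[OF v p, of _ x r]) auto
  finally show ?thesis .
qed

text \<open>
  The shell between a cube and its dilate by a factor \<open>t < 1\<close> close to 1 fills only a small
  fraction of the cube, hence holds at most half of the mass. So one step from \<open>r\<close> to \<open>t * r\<close> loses a
  factor 2 at most, and finitely many steps reach half the radius.
\<close>

lemma mass_doubling:
  assumes p: "1 < p" and K: "1 \<le> K"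
  shows "\<exists>M\<ge>1. \<forall>v (x::real^'n) r. reverse_hoelder p K v \<longrightarrow> 0 < r \<longrightarrow>
    (LINT y:cube x (2 * r)|lebesgue. v y) \<le> M * (LINT y:cube x r|lebesgue. v y)"
proof -
  let ?s = "small_fraction p K"
  \<comment> \<open>The shell between the radii \<open>t * r\<close> and \<open>r\<close> fills exactly the fraction \<open>?s\<close> of the cube.\<close>
  define t where "t = root CARD('n) (1 - ?s)"
  have t: "0 < t" "t < 1" "t ^ CARD('n) = 1 - ?s"
    using small_fraction_bounds[OF p K] by (auto simp: t_def)
  obtain N where N: "t ^ N < 1/2"
    using real_arch_pow_inv[OF _ t(2), of "1/2"] by auto
  have one: "(LINT y:cube x r|lebesgue. v y) \<le> 2 * (LINT y:cube x (t * r)|lebesgue. v y)"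
    if v: "reverse_hoelder p K v" and r: "0 < r" for v and x :: "real^'n" and r
  proof -
    have sub: "cube x (t * r) \<subseteq> cube x r"
      using t r by (intro cube_mono) (auto simp: mult_le_cancel_right1)
    have "measure lebesgue (cube x r - cube x (t * r))
        = measure lebesgue (cube x r) - measure lebesgue (cube x (t * r))"
      using sub by (intro measurable_measure_Diff) auto
    also have "\<dots> = ?s * measure lebesgue (cube x r)"
    proof -
      have "(2 * (t * r)) ^ CARD('n) = (1 - ?s) * (2 * r) ^ CARD('n)"
        using t(3) by (simp only: power_mult_distrib mult_ac)
      then show ?thesis using t r by (simp add: measure_cube left_diff_distrib)
    qed
    finally have "(LINT y:cube x r - cube x (t * r)|lebesgue. v y) \<le> (LINT y:cube x r|lebesgue. v y) / 2"
      by (intro mass_small_fraction[OF v p K r]) auto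
    then show ?thesis using mass_add_Diff[OF v _ cube_sets_lebesgue sub] p by linarith
  qed
  have iter: "(LINT y:cube x r|lebesgue. v y) \<le> 2 ^ k * (LINT y:cube x (t ^ k * r)|lebesgue. v y)"
    if v: "reverse_hoelder p K v" and r: "0 < r" for v and x :: "real^'n" and r k
  proof (induction k)
    case (Suc k)
    have "(LINT y:cube x (t ^ k * r)|lebesgue. v y) \<le> 2 * (LINT y:cube x (t ^ Suc k * r)|lebesgue. v y)"
      using one[OF v, of "t ^ k * r" x] t r by (simp add: mult_ac)
    then have step: "2 ^ k * (LINT y:cube x (t ^ k * r)|lebesgue. v y)
        \<le> 2 ^ k * (2 * (LINT y:cube x (t ^ Suc k * r)|lebesgue. v y))"
      by (intro mult_left_mono) auto
    show ?case using order_trans[OF Suc step] by (simp add: mult_ac)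
  qed simp
  show ?thesis
  proof (intro exI[of _ "2 ^ N :: real"] conjI allI impI)
    fix v :: "real^'n \<Rightarrow> real" and x :: "real^'n" and r :: real
    assume v: "reverse_hoelder p K v" and r: "0 < r"
    have "(LINT y:cube x (2 * r)|lebesgue. v y) \<le> 2 ^ N * (LINT y:cube x (t ^ N * (2 * r))|lebesgue. v y)"
      using iter[OF v] r by simp
    also have "\<dots> \<le> 2 ^ N * (LINT y:cube x r|lebesgue. v y)"
      using N r p by (intro mult_left_mono mass_mono_cube[OF v]) (auto simp: field_simps)
    finally show "(LINT y:cube x (2 * r)|lebesgue. v y) \<le> 2 ^ N * (LINT y:cube x r|lebesgue. v y)" .
  qed simp
qed

text \<open>
  The dimensionless quantity whose threshold value 1 defines \<open>m(x, v)\<close>.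
\<close>

definition scaled_mass :: "(real^'n \<Rightarrow> real) \<Rightarrow> real^'n \<Rightarrow> real \<Rightarrow> real" where
  "scaled_mass v x r = r powi (2 - int CARD('n)) * (LINT y:cube x r|lebesgue. v y)"

text \<open>
  The smaller cube is the fraction \<open>s ^ n\<close> of the larger one, so its mass is smaller by the
  factor \<open>s powr (n - n/p)\<close>; the normalisation contributes \<open>s powr (2 - n)\<close>.
\<close>

lemma scaled_mass_decay:
  fixes x :: "real^'n"
  assumes v: "reverse_hoelder p K v" and p: "1 < p" and K: "1 \<le> K" and r: "0 < r"
    and s: "0 < s" "s \<le> 1"
  shows "scaled_mass v x (s * r) \<le> 2 * K * s powr (2 - real CARD('n) / p) * scaled_mass v x r"
proof -
  let ?n = "CARD('n)"
  have "(LINT y:cube x (s * r)|lebesgue. v y)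
    \<le> 2 * K * (s ^ ?n) powr (1 - 1/p) * (LINT y:cube x r|lebesgue. v y)"
    using s r by (intro mass_subset_le[OF v p K r _ cube_mono])
      (auto simp: measure_cube power_mult_distrib mult_le_cancel_right1)
  then have "scaled_mass v x (s * r) \<le> (s * r) powi (2 - int ?n) *
      (2 * K * (s ^ ?n) powr (1 - 1/p) * (LINT y:cube x r|lebesgue. v y))"
    unfolding scaled_mass_def using s r by (intro mult_left_mono) auto
  also have "\<dots> = 2 * K * (s powi (2 - int ?n) * (s ^ ?n) powr (1 - 1/p)) * scaled_mass v x r"
    by (simp add: scaled_mass_def power_int_mult_distrib mult_ac)
  also have "s powi (2 - int ?n) * (s ^ ?n) powr (1 - 1/p) = s powr (2 - real ?n / p)"
  proof -
    have "s powi (2 - int ?n) = s powr (2 - real ?n)"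
      using s powr_real_of_int'[of s "2 - int ?n"] by simp
    moreover have "(s ^ ?n) powr (1 - 1/p) = s powr (?n * (1 - 1/p))"
      using s by (simp add: powr_realpow [symmetric] powr_powr)
    ultimately show ?thesis
      using s p by (simp add: powr_add [symmetric]) (simp add: field_simps)
  qed
  finally show ?thesis .
qed

text \<open>
  If \<open>E\<close> filled too little of the cube it would carry at most half of the mass, while its
  complement, where \<open>v\<close> is below a quarter of its average, carries at most a quarter.
\<close>

lemma reverse_hoelder_large_values:
  fixes x :: "real^'n"
  assumes v: "reverse_hoelder p K v" and p: "1 < p" and K: "1 \<le> K" and r: "0 < r"
    and I: "0 < (LINT y:cube x r|lebesgue. v y)"
  defines "E \<equiv> {y \<in> cube x r. (LINT y:cube x r|lebesgue. v y) / (4 * measure lebesgue (cube x r)) \<le> v y}"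
  shows "E \<in> sets lebesgue"
    and "small_fraction p K * measure lebesgue (cube x r) \<le> measure lebesgue E"
proof -
  let ?I = "LINT y:cube x r|lebesgue. v y" and ?m = "measure lebesgue (cube x r)"
  have m: "?m > 0" using r by (simp add: measure_cube)
  have [measurable]: "cube x r \<in> sets lebesgue" "v \<in> borel_measurable lebesgue"
    by (simp_all add: reverse_hoelder_measurable [OF v])
  have "{y \<in> space lebesgue. y \<in> cube x r \<and> ?I / (4 * ?m) \<le> v y} \<in> sets lebesgue"
    by measurable
  then show E: "E \<in> sets lebesgue" by (simp add: E_def)
  have sub: "E \<subseteq> cube x r" by (auto simp: E_def)
  show "small_fraction p K * ?m \<le> measure lebesgue E"
  proof (rule ccontr)
    assume "\<not> ?thesis"
    then have half: "(LINT y:E|lebesgue. v y) \<le> ?I / 2"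
      by (intro mass_small_fraction[OF v p K r E sub]) simp
    have D: "cube x r - E \<in> lmeasurable" using E by (intro fmeasurable_Diff) auto
    have "(LINT y:cube x r - E|lebesgue. v y) \<le> (LINT y:cube x r - E|lebesgue. ?I / (4 * ?m))"
    proof (rule set_integral_mono)
      show "set_integrable lebesgue (cube x r - E) v"
        using E p by (intro reverse_hoelder_integrable[OF v, of _ x r]) auto
      show "set_integrable lebesgue (cube x r - E) (\<lambda>y. ?I / (4 * ?m))"
        using D by (simp add: set_integrable_def lmeasurable_iff_integrable)
    qed (auto simp: E_def)
    also have "\<dots> = ?I / (4 * ?m) * measure lebesgue (cube x r - E)"
      unfolding set_lebesgue_integral_def real_scaleR_def by simp
    also have "\<dots> \<le> ?I / (4 * ?m) * ?m"
    proof (rule mult_left_mono)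
      show "measure lebesgue (cube x r - E) \<le> ?m"
        using D by (intro measure_mono_fmeasurable) auto
    qed (use I m in simp)
    also have "\<dots> = ?I / 4" using m by simp
    finally show False using half I mass_add_Diff[OF v _ E sub] p by linarith
  qed
qed

section \<open>A Poincare inequality on cubes\<close>

lemma norm_matrix_vector_mult_le:
  fixes A :: "real^'n^'d"
  shows "norm (A *v x) \<le> norm A * norm x"
proof -
  have "norm (A *v x) = L2_set (\<lambda>i. \<bar>A $ i \<bullet> x\<bar>) UNIV"
    by (simp add: norm_vec_def matrix_vector_mul_component)
  also have "\<dots> \<le> L2_set (\<lambda>i. norm (A $ i) * norm x) UNIV"
    by (intro L2_set_mono) (auto simp: Cauchy_Schwarz_ineq2)
  also have "\<dots> = norm A * norm x"
    by (simp add: norm_vec_def L2_set_left_distrib [symmetric])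
  finally show ?thesis .
qed

text \<open>
  The variance of \<open>g\<close> is nonnegative.
\<close>

lemma integral_power2_le:
  fixes g :: "real \<Rightarrow> real"
  assumes g: "continuous_on {0..1} g"
  shows "(integral {0..1} g)\<^sup>2 \<le> integral {0..1} (\<lambda>t. (g t)\<^sup>2)"
proof -
  let ?c = "integral {0..1} g"
  have "((\<lambda>t. (g t)\<^sup>2 - 2 * ?c * g t + ?c\<^sup>2) has_integral
      integral {0..1} (\<lambda>t. (g t)\<^sup>2) - 2 * ?c * ?c + ?c\<^sup>2) {0..1}"
    using g has_integral_const_real[of "?c\<^sup>2" 0 1]
    by (intro has_integral_add has_integral_diff has_integral_mult_right integrable_integral
        integrable_continuous_real continuous_intros) auto
  moreover have "0 \<le> (g t)\<^sup>2 - 2 * ?c * g t + ?c\<^sup>2" for t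
    using zero_le_power2[of "g t - ?c"] by (simp add: power2_diff algebra_simps)
  ultimately have "0 \<le> integral {0..1} (\<lambda>t. (g t)\<^sup>2) - 2 * ?c * ?c + ?c\<^sup>2"
    by (rule has_integral_nonneg)
  then show ?thesis by (simp add: power2_eq_square)
qed

text \<open>
  The fundamental theorem of calculus along the segment, followed by Cauchy-Schwarz in \<open>t\<close>.
\<close>

lemma segment_difference_bound:
  fixes u :: "real^'n \<Rightarrow> real^'d"
  assumes diff: "\<And>x. u differentiable (at x)"
    and cont: "continuous_on UNIV (\<lambda>x. jacobian u (at x))"
  shows "ennreal ((norm (u y - u x))\<^sup>2) \<le> ennreal ((norm (y - x))\<^sup>2) *
    (\<integral>\<^sup>+t. ennreal ((norm (jacobian u (at (x + t *\<^sub>R (y - x)))))\<^sup>2) * indicator {0..1} t \<partial>lborel)"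
proof -
  let ?J = "\<lambda>t. jacobian u (at (x + t *\<^sub>R (y - x)))"
  have contJ: "continuous_on {0..1} ?J"
    by (rule continuous_on_compose2[OF cont]) (auto intro!: continuous_intros)
  have cg: "continuous_on {0..1} (\<lambda>t. norm (?J t))" by (intro continuous_intros contJ)
  have int: "((\<lambda>t. ?J t *v (y - x)) has_integral (u (x + 1 *\<^sub>R (y - x)) - u (x + 0 *\<^sub>R (y - x)))) {0..1}"
  proof (rule fundamental_theorem_of_calculus)
    fix t :: real
    have "(u has_derivative (\<lambda>h. ?J t *v h)) (at (x + t *\<^sub>R (y - x)))"
      using diff jacobian_works by blast
    moreover have "((\<lambda>t. x + t *\<^sub>R (y - x)) has_derivative (\<lambda>h. h *\<^sub>R (y - x))) (at t within {0..1})"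
      by (auto intro!: derivative_eq_intros)
    ultimately have "((\<lambda>t. u (x + t *\<^sub>R (y - x))) has_derivative (\<lambda>h. ?J t *v (h *\<^sub>R (y - x)))) (at t within {0..1})"
      by (rule has_derivative_compose[rotated])
    then show "((\<lambda>t. u (x + t *\<^sub>R (y - x))) has_vector_derivative ?J t *v (y - x)) (at t within {0..1})"
      by (simp add: has_vector_derivative_def matrix_vector_mult_scaleR)
  qed simp
  have "norm (u y - u x) = norm (integral {0..1} (\<lambda>t. ?J t *v (y - x)))"
    using int by (simp add: integral_unique)
  also have "\<dots> \<le> integral {0..1} (\<lambda>t. norm (?J t) * norm (y - x))"
  proof (rule Henstock_Kurzweil_Integration.integral_norm_bound_integral)
    show "(\<lambda>t. ?J t *v (y - x)) integrable_on {0..1}" using int by (auto simp: has_integral_iff)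
    show "(\<lambda>t. norm (?J t) * norm (y - x)) integrable_on {0..1}"
      by (intro integrable_continuous_real continuous_intros cg)
  qed (rule norm_matrix_vector_mult_le)
  also have "\<dots> = integral {0..1} (\<lambda>t. norm (?J t)) * norm (y - x)" by simp
  finally have "(norm (u y - u x))\<^sup>2 \<le> (integral {0..1} (\<lambda>t. norm (?J t)) * norm (y - x))\<^sup>2"
    by (intro power_mono) auto
  also have "\<dots> \<le> (norm (y - x))\<^sup>2 * integral {0..1} (\<lambda>t. (norm (?J t))\<^sup>2)"
    using integral_power2_le[OF cg] by (simp add: power_mult_distrib mult.commute mult_left_mono)
  finally have "ennreal ((norm (u y - u x))\<^sup>2)
      \<le> ennreal ((norm (y - x))\<^sup>2 * integral {0..1} (\<lambda>t. (norm (?J t))\<^sup>2))"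
    by (rule ennreal_leI)
  also have "\<dots> = ennreal ((norm (y - x))\<^sup>2) * ennreal (integral {0..1} (\<lambda>t. (norm (?J t))\<^sup>2))"
    by (simp add: ennreal_mult')
  also have "ennreal (integral {0..1} (\<lambda>t. (norm (?J t))\<^sup>2))
    = (\<integral>\<^sup>+t. ennreal ((norm (?J t))\<^sup>2) * indicator {0..1} t \<partial>lborel)"
  proof -
    have "((\<lambda>t. (norm (?J t))\<^sup>2) has_integral integral {0..1} (\<lambda>t. (norm (?J t))\<^sup>2)) {0..1}"
      by (intro integrable_integral integrable_continuous_real continuous_intros contJ)
    from nn_integral_has_integral_lebesgue[OF _ this] show ?thesis
      by (simp add: indicator_mult_ennreal [symmetric] mult.commute)
  qed
  finally show ?thesis .
qed

lemma nn_integral_lborel_affine: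
  fixes G :: "'a::euclidean_space \<Rightarrow> ennreal"
  assumes [measurable]: "G \<in> borel_measurable borel" and c: "0 < c"
  shows "(\<integral>\<^sup>+y. G (a + c *\<^sub>R y) \<partial>lborel) = ennreal ((1/c) ^ DIM('a)) * (\<integral>\<^sup>+y. G y \<partial>lborel)"
proof -
  have "(\<integral>\<^sup>+y. G y \<partial>lborel) = (\<integral>\<^sup>+y. G y \<partial>density (distr lborel borel (\<lambda>x. a + c *\<^sub>R x)) (\<lambda>_. ennreal (\<bar>c\<bar>^DIM('a))))"
    using lborel_affine[of c a] c by simp
  also have "\<dots> = ennreal (c^DIM('a)) * (\<integral>\<^sup>+y. G (a + c *\<^sub>R y) \<partial>lborel)"
    using c by (simp add: nn_integral_density nn_integral_distr nn_integral_cmult)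
  finally have "ennreal ((1/c) ^ DIM('a)) * (\<integral>\<^sup>+y. G y \<partial>lborel)
      = ennreal ((1/c) ^ DIM('a) * c^DIM('a)) * (\<integral>\<^sup>+y. G (a + c *\<^sub>R y) \<partial>lborel)"
    using c by (simp add: ennreal_mult' mult.assoc)
  also have "(1/c) ^ DIM('a) * c^DIM('a) = 1"
    using c by (simp add: power_mult_distrib [symmetric])
  finally show ?thesis by simp
qed

lemma emeasure_cube:
  fixes c :: "real^'n" and r :: real
  assumes "0 \<le> r" shows "emeasure lborel (cube c r) = ennreal ((2 * r) ^ CARD('n))"
proof -
  have "emeasure lborel (cube c r) = ennreal (measure lborel (cube c r))"
    by (intro emeasure_eq_ennreal_measure) (simp add: cube_eq_cbox emeasure_lborel_cbox_eq)
  then show ?thesis using assms by (simp add: measure_cube)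
qed

lemma segment_in_cube:
  assumes "x \<in> cube c r" "y \<in> cube c r" "0 \<le> t" "t \<le> (1::real)"
  shows "x + t *\<^sub>R (y - x) \<in> cube c r"
proof -
  have "(1 - t) *\<^sub>R x + t *\<^sub>R y \<in> cube c r"
    using assms convexD[of "cube c r" x y "1 - t" t] by (simp add: cube_eq_cbox)
  then show ?thesis by (simp add: algebra_simps)
qed

lemma norm_diff_cube:
  fixes c :: "real^'n" and r :: real
  assumes "x \<in> cube c r" "y \<in> cube c r"
  shows "(norm (y - x))\<^sup>2 \<le> CARD('n) * (2 * r)\<^sup>2"
proof -
  have "(y $ i - x $ i)\<^sup>2 \<le> (2 * r)\<^sup>2" for i
  proof -
    have "\<bar>y $ i - x $ i\<bar> \<le> 2 * r"
      using assms(1)[unfolded cube_def, THEN CollectD, THEN spec, of i]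
        assms(2)[unfolded cube_def, THEN CollectD, THEN spec, of i] by linarith
    then show ?thesis using abs_le_square_iff[of "y $ i - x $ i" "2 * r"] by linarith
  qed
  then have "(\<Sum>i\<in>UNIV. (y $ i - x $ i)\<^sup>2) \<le> (\<Sum>i\<in>(UNIV::'n set). (2 * r)\<^sup>2)"
    by (rule sum_mono)
  then show ?thesis by (simp add: norm_vec_def L2_set_def sum_nonneg)
qed

text \<open>
  For \<open>t \<ge> 1/2\<close> and fixed \<open>x\<close>, the substitution \<open>z = x + t (y - x)\<close> has Jacobian \<open>t ^ n \<ge> 2 ^ (- n)\<close>.
  For \<open>t < 1/2\<close> this degenerates, and the substitution is made in \<open>x\<close> for fixed \<open>y\<close> instead.
\<close>

lemma nn_integral_segment_le:
  fixes G :: "real^'n \<Rightarrow> ennreal"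
  assumes [measurable]: "G \<in> borel_measurable borel" and r: "0 < r" and t: "0 \<le> t" "t \<le> 1"
  shows "(\<integral>\<^sup>+x. (\<integral>\<^sup>+y. G (x + t *\<^sub>R (y - x)) * indicator (cube c r) x * indicator (cube c r) y \<partial>lborel) \<partial>lborel)
     \<le> ennreal ((4 * r) ^ CARD('n)) * (\<integral>\<^sup>+z. G z \<partial>lborel)"
proof -
  have key: "(\<integral>\<^sup>+x. (\<integral>\<^sup>+y. G ((1 - t) *\<^sub>R x + t *\<^sub>R y) * indicator (cube c r) x * indicator (cube c r) y \<partial>lborel) \<partial>lborel)
     \<le> ennreal ((4 * r) ^ CARD('n)) * (\<integral>\<^sup>+z. G z \<partial>lborel)" if "1/2 \<le> t" for t
  proof -
    have "(\<integral>\<^sup>+y. G ((1 - t) *\<^sub>R x + t *\<^sub>R y) * indicator (cube c r) x * indicator (cube c r) y \<partial>lborel)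
       \<le> ennreal (2 ^ CARD('n)) * (\<integral>\<^sup>+z. G z \<partial>lborel) * indicator (cube c r) x" for x
    proof -
      have "(\<integral>\<^sup>+y. G ((1 - t) *\<^sub>R x + t *\<^sub>R y) * indicator (cube c r) x * indicator (cube c r) y \<partial>lborel)
        \<le> (\<integral>\<^sup>+y. G ((1 - t) *\<^sub>R x + t *\<^sub>R y) * indicator (cube c r) x \<partial>lborel)"
        by (intro nn_integral_mono) (auto simp: indicator_def)
      also have "\<dots> = ennreal ((1/t) ^ CARD('n)) * (\<integral>\<^sup>+z. G z \<partial>lborel) * indicator (cube c r) x"
        using that by (simp add: nn_integral_multc nn_integral_lborel_affine)
      also have "\<dots> \<le> ennreal (2 ^ CARD('n)) * (\<integral>\<^sup>+z. G z \<partial>lborel) * indicator (cube c r) x"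
        using that by (intro mult_right_mono ennreal_leI power_mono) (auto simp: field_simps)
      finally show ?thesis .
    qed
    then have "(\<integral>\<^sup>+x. (\<integral>\<^sup>+y. G ((1 - t) *\<^sub>R x + t *\<^sub>R y) * indicator (cube c r) x * indicator (cube c r) y \<partial>lborel) \<partial>lborel)
      \<le> (\<integral>\<^sup>+x. ennreal (2 ^ CARD('n)) * (\<integral>\<^sup>+z. G z \<partial>lborel) * indicator (cube c r) x \<partial>lborel)"
      by (rule nn_integral_mono)
    also have "\<dots> = ennreal (2 ^ CARD('n)) * (\<integral>\<^sup>+z. G z \<partial>lborel) * ennreal ((2 * r) ^ CARD('n))"
      using r by (simp add: nn_integral_cmult_indicator cube_sets_borel emeasure_cube)
    also have "\<dots> = ennreal (2 ^ CARD('n) * (2 * r) ^ CARD('n)) * (\<integral>\<^sup>+z. G z \<partial>lborel)"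
      using r by (simp add: ennreal_mult mult_ac)
    also have "(2 :: real) ^ CARD('n) * (2 * r) ^ CARD('n) = (4 * r) ^ CARD('n)"
      by (simp only: power_mult_distrib [symmetric] mult.assoc [symmetric]) simp
    finally show ?thesis .
  qed
  have eq: "x + t *\<^sub>R (y - x) = (1 - t) *\<^sub>R x + t *\<^sub>R y" for x y :: "real^'n"
    by (simp add: algebra_simps)
  show ?thesis
  proof (cases "1/2 \<le> t")
    case True then show ?thesis using key[of t] unfolding eq by simp
  next
    case False
    have "(\<integral>\<^sup>+x. (\<integral>\<^sup>+y. G ((1 - t) *\<^sub>R x + t *\<^sub>R y) * indicator (cube c r) x * indicator (cube c r) y \<partial>lborel) \<partial>lborel)
      = (\<integral>\<^sup>+y. (\<integral>\<^sup>+x. G ((1 - t) *\<^sub>R x + t *\<^sub>R y) * indicator (cube c r) x * indicator (cube c r) y \<partial>lborel) \<partial>lborel)"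
      by (rule lborel_pair.Fubini') measurable
    also have "\<dots> = (\<integral>\<^sup>+y. (\<integral>\<^sup>+x. G ((1 - (1 - t)) *\<^sub>R y + (1 - t) *\<^sub>R x) * indicator (cube c r) y * indicator (cube c r) x \<partial>lborel) \<partial>lborel)"
      by (simp add: mult_ac add.commute)
    finally show ?thesis using key[of "1 - t"] False unfolding eq by simp
  qed
qed

text \<open>
  The difference \<open>u y - u x\<close> is an integral of the derivative over a segment inside the cube;
  averaging over all segments spreads the derivative evenly over the cube.
\<close>

lemma poincare_cube:
  fixes u :: "real^'n \<Rightarrow> real^'d" and r :: real
  assumes diff: "\<And>x. u differentiable (at x)"
    and cont: "continuous_on UNIV (\<lambda>x. jacobian u (at x))" and r: "0 < r"
  shows "(\<integral>\<^sup>+x\<in>cube c r. (\<integral>\<^sup>+y\<in>cube c r. ennreal ((norm (u y - u x))\<^sup>2) \<partial>lborel) \<partial>lborel)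
    \<le> ennreal (CARD('n) * (2 * r)\<^sup>2 * (4 * r) ^ CARD('n)) *
        (\<integral>\<^sup>+z\<in>cube c r. ennreal ((norm (jacobian u (at z)))\<^sup>2) \<partial>lborel)"
proof -
  have [measurable]: "(\<lambda>z. jacobian u (at z)) \<in> borel_measurable borel"
    using cont by (rule borel_measurable_continuous_onI)
  define Q where "Q = cube c r"
  have [measurable]: "Q \<in> sets borel" by (simp add: Q_def cube_sets_borel)
  define G where "G z = ennreal ((norm (jacobian u (at z)))\<^sup>2) * indicator Q z" for z
  have G[measurable]: "G \<in> borel_measurable borel" unfolding G_def by measurable
  let ?H = "\<lambda>x y t. G (x + t *\<^sub>R (y - x)) * indicator Q x * indicator Q y * indicator {0..1::real} t"
  let ?k = "ennreal (CARD('n) * (2 * r)\<^sup>2)"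
  have pt: "ennreal ((norm (u y - u x))\<^sup>2) * indicator Q y * indicator Q x
      \<le> ?k * (\<integral>\<^sup>+t. ?H x y t \<partial>lborel)" for x y
  proof (cases "x \<in> Q \<and> y \<in> Q")
    case True
    have "ennreal ((norm (u y - u x))\<^sup>2) \<le> ennreal ((norm (y - x))\<^sup>2) *
      (\<integral>\<^sup>+t. ennreal ((norm (jacobian u (at (x + t *\<^sub>R (y - x)))))\<^sup>2) * indicator {0..1} t \<partial>lborel)"
      by (rule segment_difference_bound[OF diff cont])
    also have "(\<integral>\<^sup>+t. ennreal ((norm (jacobian u (at (x + t *\<^sub>R (y - x)))))\<^sup>2) * indicator {0..1} t \<partial>lborel)
        = (\<integral>\<^sup>+t. ?H x y t \<partial>lborel)"
      using True segment_in_cube[of x c r y]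
      by (intro nn_integral_cong) (auto simp: G_def Q_def split: split_indicator)
    also have "ennreal ((norm (y - x))\<^sup>2) \<le> ?k"
      using True norm_diff_cube[of x c r y] by (intro ennreal_leI) (auto simp: Q_def)
    finally show ?thesis using True by (simp add: mult_right_mono)
  qed (auto simp: indicator_def)
  have "(\<integral>\<^sup>+x\<in>Q. (\<integral>\<^sup>+y\<in>Q. ennreal ((norm (u y - u x))\<^sup>2) \<partial>lborel) \<partial>lborel)
      = (\<integral>\<^sup>+x. (\<integral>\<^sup>+y. ennreal ((norm (u y - u x))\<^sup>2) * indicator Q y * indicator Q x \<partial>lborel) \<partial>lborel)"
  proof -
    have "continuous_on UNIV u"
      using diff by (simp add: continuous_on_eq_continuous_at differentiable_imp_continuous_within)
    then have [measurable]: "u \<in> borel_measurable borel" by (rule borel_measurable_continuous_onI)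
    show ?thesis by (simp add: nn_integral_multc)
  qed
  also have "\<dots> \<le> (\<integral>\<^sup>+x. (\<integral>\<^sup>+y. ?k * (\<integral>\<^sup>+t. ?H x y t \<partial>lborel) \<partial>lborel) \<partial>lborel)"
    by (intro nn_integral_mono pt)
  also have "\<dots> = ?k * (\<integral>\<^sup>+x. (\<integral>\<^sup>+y. (\<integral>\<^sup>+t. ?H x y t \<partial>lborel) \<partial>lborel) \<partial>lborel)"
  proof -
    have "(\<integral>\<^sup>+y. ?k * (\<integral>\<^sup>+t. ?H x y t \<partial>lborel) \<partial>lborel)
        = ?k * (\<integral>\<^sup>+y. (\<integral>\<^sup>+t. ?H x y t \<partial>lborel) \<partial>lborel)" for x
      by (rule nn_integral_cmult) measurable
    then show ?thesis
      by (simp only:) (rule nn_integral_cmult, measurable)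
  qed
  also have "(\<integral>\<^sup>+x. (\<integral>\<^sup>+y. (\<integral>\<^sup>+t. ?H x y t \<partial>lborel) \<partial>lborel) \<partial>lborel)
      = (\<integral>\<^sup>+x. (\<integral>\<^sup>+t. (\<integral>\<^sup>+y. ?H x y t \<partial>lborel) \<partial>lborel) \<partial>lborel)"
    by (intro nn_integral_cong lborel_pair.Fubini') measurable
  also have "\<dots> = (\<integral>\<^sup>+t. (\<integral>\<^sup>+x. (\<integral>\<^sup>+y. ?H x y t \<partial>lborel) \<partial>lborel) \<partial>lborel)"
    by (intro lborel_pair.Fubini') measurable
  also have "\<dots> \<le> (\<integral>\<^sup>+t. ennreal ((4 * r) ^ CARD('n)) * (\<integral>\<^sup>+z. G z \<partial>lborel) * indicator {0..1::real} t \<partial>lborel)"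
  proof (rule nn_integral_mono)
    fix t :: real
    show "(\<integral>\<^sup>+x. (\<integral>\<^sup>+y. ?H x y t \<partial>lborel) \<partial>lborel)
      \<le> ennreal ((4 * r) ^ CARD('n)) * (\<integral>\<^sup>+z. G z \<partial>lborel) * indicator {0..1::real} t"
      using nn_integral_segment_le[OF G r, of t c] by (auto simp: indicator_def Q_def)
  qed
  also have "\<dots> = ennreal ((4 * r) ^ CARD('n)) * (\<integral>\<^sup>+z. G z \<partial>lborel)"
    by (simp add: nn_integral_cmult_indicator)
  finally show ?thesis
    using r by (simp add: mult_left_mono ennreal_mult mult.assoc G_def Q_def)
qed

section \<open>The energy estimate on one cube\<close>

text \<open>
  For \<open>y \<in> E\<close>, \<open>\<delta>/r\<^sup>2 \<bar>u x\<bar>\<^sup>2 \<le> 2 v(y) \<bar>u y\<bar>\<^sup>2 + 2 \<delta>/r\<^sup>2 \<bar>u y - u x\<bar>\<^sup>2\<close>. Integrating over \<open>y \<in> E\<close>, where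
  the left-hand side gains the measure of \<open>E\<close>, and then over \<open>x\<close> in the cube leaves
  the potential energy and the double integral of the Poincare inequality. Integrating in this order
  keeps \<open>v\<close>, which is only Lebesgue measurable, out of Fubini's theorem.
\<close>

lemma local_energy_bound:
  fixes u :: "real^'n \<Rightarrow> real^'d" and r :: real
  assumes diff: "\<And>x. u differentiable (at x)"
    and cont: "continuous_on UNIV (\<lambda>x. jacobian u (at x))" and r: "0 < r"
    and v0: "\<And>x. 0 \<le> v x" and vm: "v \<in> borel_measurable lebesgue"
    and E: "E \<in> sets lebesgue" "E \<subseteq> cube c r"
    and \<kappa>: "0 < \<kappa>" "\<kappa> * measure lebesgue (cube c r) \<le> measure lebesgue E"
    and \<delta>: "0 < \<delta>" "\<And>y. y \<in> E \<Longrightarrow> \<delta> / r\<^sup>2 \<le> v y"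
  shows "(\<integral>\<^sup>+x\<in>cube c r. ennreal ((norm (u x))\<^sup>2 / r\<^sup>2) \<partial>lebesgue)
    \<le> ennreal (2 / (\<delta> * \<kappa>) + 8 * real CARD('n) * 2 ^ CARD('n) / \<kappa>) *
      ((\<integral>\<^sup>+x\<in>cube c r. ennreal ((norm (jacobian u (at x)))\<^sup>2) \<partial>lebesgue)
       + (\<integral>\<^sup>+x\<in>cube c r. ennreal (v x * (norm (u x))\<^sup>2) \<partial>lebesgue))"
proof -
  define Q where "Q = cube c r"
  have Qb[measurable]: "Q \<in> sets borel" by (simp add: Q_def cube_sets_borel)
  have Ql[measurable]: "Q \<in> sets lebesgue" by (simp add: Q_def)
  have "continuous_on UNIV u"
    using diff by (simp add: continuous_on_eq_continuous_at differentiable_imp_continuous_within)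
  then have ub[measurable]: "u \<in> borel_measurable borel" by (rule borel_measurable_continuous_onI)
  then have ul[measurable]: "u \<in> borel_measurable lebesgue"
    by (intro measurable_completion) simp
  note vm[measurable]
  define B where "B = (\<integral>\<^sup>+x\<in>Q. ennreal (v x * (norm (u x))\<^sup>2) \<partial>lebesgue)"
  define D where "D = (\<integral>\<^sup>+x\<in>Q. ennreal ((norm (jacobian u (at x)))\<^sup>2) \<partial>lebesgue)"
  define P where "P x = (\<integral>\<^sup>+y\<in>Q. ennreal ((norm (u y - u x))\<^sup>2) \<partial>lborel)" for x
  have Pm[measurable]: "P \<in> borel_measurable borel" unfolding P_def by measurable
  let ?q = "(2 * r) ^ CARD('n)"
  have q: "0 < ?q" using r by simp
  have Em: "E \<in> lmeasurable" using E by (meson cube_lmeasurable fmeasurableI2)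
  have point: "ennreal (\<delta> * \<kappa> * ?q) * ennreal ((norm (u x))\<^sup>2 / r\<^sup>2)
      \<le> 2 * B + ennreal (2 * \<delta> / r\<^sup>2) * P x" for x
  proof -
    have "ennreal (\<delta> * \<kappa> * ?q) * ennreal ((norm (u x))\<^sup>2 / r\<^sup>2)
        = ennreal (\<delta> / r\<^sup>2 * (norm (u x))\<^sup>2) * ennreal (\<kappa> * ?q)"
      using \<delta> \<kappa> r by (simp add: ennreal_mult [symmetric] mult_ac)
    also have "\<dots> \<le> ennreal (\<delta> / r\<^sup>2 * (norm (u x))\<^sup>2) * emeasure lebesgue E"
      using \<kappa> r Em by (intro mult_left_mono) (auto simp: measure_cube emeasure_eq_measure2 ennreal_leI)
    also have "\<dots> = (\<integral>\<^sup>+y. ennreal (\<delta> / r\<^sup>2 * (norm (u x))\<^sup>2) * indicator E y \<partial>lebesgue)"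
      using E by (simp add: nn_integral_cmult_indicator)
    also have "\<dots> \<le> (\<integral>\<^sup>+y. 2 * (ennreal (v y * (norm (u y))\<^sup>2) * indicator Q y)
        + ennreal (2 * \<delta> / r\<^sup>2) * (ennreal ((norm (u y - u x))\<^sup>2) * indicator Q y) \<partial>lebesgue)"
    proof (rule nn_integral_mono)
      fix y
      show "ennreal (\<delta> / r\<^sup>2 * (norm (u x))\<^sup>2) * indicator E y
        \<le> 2 * (ennreal (v y * (norm (u y))\<^sup>2) * indicator Q y)
        + ennreal (2 * \<delta> / r\<^sup>2) * (ennreal ((norm (u y - u x))\<^sup>2) * indicator Q y)"
      proof (cases "y \<in> E")
        case True
        have "(norm (u x))\<^sup>2 \<le> (norm (u y) + norm (u y - u x))\<^sup>2"
          using norm_triangle_sub[of "u x" "u y"] by (intro power_mono) (auto simp: norm_minus_commute)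
        also have "\<dots> \<le> 2 * (norm (u y))\<^sup>2 + 2 * (norm (u y - u x))\<^sup>2"
          using sum_squares_bound[of "norm (u y)" "norm (u y - u x)"] by (simp add: power2_sum)
        finally have "\<delta> / r\<^sup>2 * (norm (u x))\<^sup>2
            \<le> \<delta> / r\<^sup>2 * (2 * (norm (u y))\<^sup>2 + 2 * (norm (u y - u x))\<^sup>2)"
          using \<delta> by (intro mult_left_mono) auto
        also have "\<dots> = 2 * (\<delta> / r\<^sup>2 * (norm (u y))\<^sup>2) + 2 * \<delta> / r\<^sup>2 * (norm (u y - u x))\<^sup>2"
          by (simp add: algebra_simps)
        also have "\<dots> \<le> 2 * (v y * (norm (u y))\<^sup>2) + 2 * \<delta> / r\<^sup>2 * (norm (u y - u x))\<^sup>2"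
          using \<delta>(2)[OF True] by (intro add_right_mono mult_left_mono mult_right_mono) auto
        finally have "ennreal (\<delta> / r\<^sup>2 * (norm (u x))\<^sup>2)
          \<le> ennreal (2 * (v y * (norm (u y))\<^sup>2) + 2 * \<delta> / r\<^sup>2 * (norm (u y - u x))\<^sup>2)"
          by (rule ennreal_leI)
        also have "\<dots> = ennreal 2 * ennreal (v y * (norm (u y))\<^sup>2)
            + ennreal (2 * \<delta> / r\<^sup>2) * ennreal ((norm (u y - u x))\<^sup>2)"
          using \<delta> v0[of y] by (simp only: ennreal_mult ennreal_plus mult_nonneg_nonneg zero_le_power2
              zero_le_divide_iff zero_le_numeral less_imp_le simp_thms)
        finally show ?thesis using True E(2) by (auto simp: Q_def)
      qed simp
    qed
    also have "\<dots> = 2 * B + ennreal (2 * \<delta> / r\<^sup>2) *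
        (\<integral>\<^sup>+y. ennreal ((norm (u y - u x))\<^sup>2) * indicator Q y \<partial>lebesgue)"
      unfolding B_def by (subst nn_integral_add) (auto simp: nn_integral_cmult)
    finally show ?thesis by (simp add: P_def nn_integral_completion)
  qed
  have "ennreal (\<delta> * \<kappa> * ?q) * (\<integral>\<^sup>+x\<in>Q. ennreal ((norm (u x))\<^sup>2 / r\<^sup>2) \<partial>lebesgue)
      = (\<integral>\<^sup>+x. ennreal (\<delta> * \<kappa> * ?q) * (ennreal ((norm (u x))\<^sup>2 / r\<^sup>2) * indicator Q x) \<partial>lborel)"
    unfolding nn_integral_completion by (rule nn_integral_cmult[symmetric]) measurable
  also have "\<dots> \<le> (\<integral>\<^sup>+x. 2 * B * indicator Q x + ennreal (2 * \<delta> / r\<^sup>2) * (P x * indicator Q x) \<partial>lborel)"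
  proof (rule nn_integral_mono)
    show "ennreal (\<delta> * \<kappa> * ?q) * (ennreal ((norm (u x))\<^sup>2 / r\<^sup>2) * indicator Q x)
       \<le> 2 * B * indicator Q x + ennreal (2 * \<delta> / r\<^sup>2) * (P x * indicator Q x)" for x
      using point[of x] by (cases "x \<in> Q") auto
  qed
  also have "\<dots> = 2 * B * ennreal ?q + ennreal (2 * \<delta> / r\<^sup>2) * (\<integral>\<^sup>+x\<in>Q. P x \<partial>lborel)"
  proof -
    have "emeasure lborel Q = ennreal ?q" using r by (simp add: Q_def emeasure_cube)
    then show ?thesis
      by (subst nn_integral_add) (auto simp: nn_integral_cmult nn_integral_cmult_indicator)
  qed
  also have "\<dots> \<le> 2 * B * ennreal ?q + ennreal (2 * \<delta> / r\<^sup>2) *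
      (ennreal (CARD('n) * (2 * r)\<^sup>2 * (4 * r) ^ CARD('n)) * D)"
    using poincare_cube[OF diff cont r, of c]
    by (intro add_left_mono mult_left_mono) (auto simp: P_def Q_def D_def nn_integral_completion)
  also have "\<dots> = ennreal (2 * ?q) * B + ennreal (8 * \<delta> * CARD('n) * 2 ^ CARD('n) * ?q) * D"
  proof -
    have "2 * \<delta> / r\<^sup>2 * (CARD('n) * (2 * r)\<^sup>2 * (4 * r) ^ CARD('n))
        = 8 * \<delta> * CARD('n) * (2 * (2 * r)) ^ CARD('n)"
      using r by (simp add: power2_eq_square)
    also have "\<dots> = 8 * \<delta> * CARD('n) * 2 ^ CARD('n) * ?q"
      by (simp only: power_mult_distrib mult_ac)
    finally have "ennreal (2 * \<delta> / r\<^sup>2) * ennreal (CARD('n) * (2 * r)\<^sup>2 * (4 * r) ^ CARD('n))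
        = ennreal (8 * \<delta> * CARD('n) * 2 ^ CARD('n) * ?q)"
      using \<delta> by (subst ennreal_mult' [symmetric]) auto
    moreover have "2 * B * ennreal ?q = ennreal (2 * ?q) * B"
      using q by (simp add: ennreal_mult' mult_ac)
    ultimately show ?thesis by (simp only: mult.assoc [symmetric])
  qed
  finally have main: "ennreal (\<delta> * \<kappa> * ?q) * (\<integral>\<^sup>+x\<in>Q. ennreal ((norm (u x))\<^sup>2 / r\<^sup>2) \<partial>lebesgue)
    \<le> ennreal (2 * ?q) * B + ennreal (8 * \<delta> * CARD('n) * 2 ^ CARD('n) * ?q) * D" .
  let ?i = "1 / (\<delta> * \<kappa> * ?q)"
  have i: "0 \<le> ?i" using \<delta> \<kappa> q by simp
  have "(\<integral>\<^sup>+x\<in>Q. ennreal ((norm (u x))\<^sup>2 / r\<^sup>2) \<partial>lebesgue)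
    = ennreal (?i * (\<delta> * \<kappa> * ?q)) * (\<integral>\<^sup>+x\<in>Q. ennreal ((norm (u x))\<^sup>2 / r\<^sup>2) \<partial>lebesgue)"
    using \<delta> \<kappa> q by simp
  also have "\<dots> = ennreal ?i *
      (ennreal (\<delta> * \<kappa> * ?q) * (\<integral>\<^sup>+x\<in>Q. ennreal ((norm (u x))\<^sup>2 / r\<^sup>2) \<partial>lebesgue))"
    using i by (simp only: ennreal_mult' mult.assoc)
  also have "\<dots> \<le> ennreal ?i *
      (ennreal (2 * ?q) * B + ennreal (8 * \<delta> * CARD('n) * 2 ^ CARD('n) * ?q) * D)"
    using main by (rule mult_left_mono) simp
  also have "\<dots> = ennreal (?i * (2 * ?q)) * B + ennreal (?i * (8 * \<delta> * CARD('n) * 2 ^ CARD('n) * ?q)) * D"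
    using i by (simp only: ennreal_mult' mult.assoc distrib_left)
  also have "?i * (2 * ?q) = 2 / (\<delta> * \<kappa>)" using \<delta> \<kappa> q r by (simp add: field_simps)
  also have "?i * (8 * \<delta> * CARD('n) * 2 ^ CARD('n) * ?q) = 8 * real CARD('n) * 2 ^ CARD('n) / \<kappa>"
  proof -
    have cancel: "(1 / (d * k * w)) * (8 * d * m * e * w) = 8 * m * e / k" if "0 < d" "0 < w" for d k w m e :: real
      using that by (cases "k = 0") (auto simp: field_simps)
    show ?thesis by (rule cancel[OF \<delta>(1) q])
  qed
  also have "ennreal (2 / (\<delta> * \<kappa>)) * B + ennreal (8 * real CARD('n) * 2 ^ CARD('n) / \<kappa>) * D
      \<le> ennreal (2 / (\<delta> * \<kappa>) + 8 * real CARD('n) * 2 ^ CARD('n) / \<kappa>) * B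
        + ennreal (2 / (\<delta> * \<kappa>) + 8 * real CARD('n) * 2 ^ CARD('n) / \<kappa>) * D"
    using \<delta> \<kappa> by (intro add_mono mult_right_mono ennreal_leI) auto
  finally show ?thesis by (simp add: distrib_left add.commute B_def D_def Q_def)
qed

section \<open>Dyadic cells and the stopping level\<close>

text \<open>
  The cells of level \<open>k\<close> are half-open cubes of side \<open>2 * 2 powi k\<close>, so that the matching closed
  cube is \<open>cube (cell_center k z) (2 powi k)\<close>, \<open>cube\<close> being parametrised by half its side.
\<close>

definition cell_index :: "int \<Rightarrow> real^'n \<Rightarrow> int^'n" where
  "cell_index k x = (\<chi> i. \<lfloor>x $ i / (2 * 2 powi k)\<rfloor>)"

definition cell_center :: "int \<Rightarrow> int^'n \<Rightarrow> real^'n" where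
  "cell_center k z = (\<chi> i. (2 * of_int (z $ i) + 1) * 2 powi k)"

definition cell :: "int \<Rightarrow> int^'n \<Rightarrow> (real^'n) set" where
  "cell k z = {x. cell_index k x = z}"

lemma cell_eq:
  "cell k z = {x. \<forall>i. 2 * of_int (z $ i) * 2 powi k \<le> x $ i \<and> x $ i < (2 * of_int (z $ i) + 2) * 2 powi k}"
  by (auto simp: cell_def cell_index_def vec_eq_iff floor_eq_iff field_simps)

lemma cell_index_center:
  "\<bar>x $ i - cell_center k (cell_index k x) $ i\<bar> \<le> 2 powi k"
proof -
  have "x \<in> cell k (cell_index k x)" by (simp add: cell_def)
  then have "2 * of_int (cell_index k x $ i) * 2 powi k \<le> x $ i"
    "x $ i < (2 * of_int (cell_index k x $ i) + 2) * 2 powi k"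
    by (auto simp: cell_eq)
  then show ?thesis by (simp add: cell_center_def abs_le_iff algebra_simps)
qed

text \<open>
  The dyadic cells are nested: halving the resolution divides the integer coordinates by 2.
\<close>

lemma cell_index_coarsen:
  fixes x y :: "real^'n"
  assumes "cell_index k x = cell_index k y" "k \<le> j"
  shows "cell_index j x = cell_index j y"
proof -
  have "cell_index j w $ i = cell_index k w $ i div 2 ^ nat (j - k)" for w :: "real^'n" and i
  proof -
    have "(2::real) powi j = 2 powi k * 2 ^ nat (j - k)"
      using assms(2) by (simp add: power_int_add [symmetric] flip: power_int_of_nat)
    then have "w $ i / (2 * 2 powi j) = w $ i / (2 * 2 powi k) / real_of_int (2 ^ nat (j - k))"
      by (simp add: field_simps)
    then show ?thesis by (simp only: cell_index_def vec_lambda_beta) (rule floor_divide_real_eq_div, simp)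
  qed
  then show ?thesis using assms(1) by (simp add: vec_eq_iff)
qed

lemma cell_sets_borel [measurable]: "cell k z \<in> sets borel"
proof -
  have [measurable]: "(\<lambda>x::real^'a. x $ i) \<in> borel_measurable borel" for i
    by (intro borel_measurable_continuous_onI continuous_intros)
  have "cell k z = {x \<in> space borel. \<forall>i. 2 * of_int (z $ i) * 2 powi k \<le> x $ i
      \<and> x $ i < (2 * of_int (z $ i) + 2) * 2 powi k}"
    by (simp add: cell_eq)
  also have "\<dots> \<in> sets borel" by measurable
  finally show ?thesis .
qed

text \<open>
  The half-open cell and the closed cube differ by upper faces, which lie in finitely many hyperplanes.
\<close>

lemma nn_integral_cell_eq_cube:
  "(\<integral>\<^sup>+x\<in>cell k z. f x \<partial>lebesgue) = (\<integral>\<^sup>+x\<in>cube (cell_center k z) (2 powi k). f x \<partial>lebesgue)"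
proof (rule nn_integral_cong_AE)
  let ?N = "\<Union>i. {x::real^'a. x \<bullet> axis i 1 = (2 * of_int (z $ i) + 2) * 2 powi k}"
  have "negligible ?N"
    by (intro negligible_Union) (auto intro!: negligible_standard_hyperplane simp: axis_in_Basis_iff)
  then have "?N \<in> null_sets lebesgue" by (simp add: negligible_iff_null_sets)
  moreover have "x \<in> cell k z \<longleftrightarrow> x \<in> cube (cell_center k z) (2 powi k)" if "x \<notin> ?N" for x
  proof -
    have "x $ i \<noteq> (2 * of_int (z $ i) + 2) * 2 powi k" for i
      using that by (auto simp: inner_axis)
    moreover have "(2 * a * h \<le> t \<and> t < (2 * a + 2) * h) \<longleftrightarrow> \<bar>t - (2 * a + 1) * h\<bar> \<le> h"
      if "t \<noteq> (2 * a + 2) * h" for a h t :: real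
      using that by (simp add: abs_le_iff algebra_simps) linarith
    ultimately show ?thesis by (auto simp: cell_eq cube_def cell_center_def)
  qed
  ultimately show "AE x in lebesgue. f x * indicator (cell k z) x
      = f x * indicator (cube (cell_center k z) (2 powi k)) x"
    by (intro AE_I'[of ?N]) (auto simp: indicator_def)
qed

lemma inverse_ennreal_antimono: "(a::ennreal) \<le> b \<Longrightarrow> inverse b \<le> inverse a"
  including ennreal.lifting by transfer (rule ereal_inverse_antimono)

text \<open>
  Any admissible radius bounds the supremum from below, hence \<open>m\<close> from above.
\<close>

lemma aux_m_le:
  assumes v: "reverse_hoelder p K v" and p: "1 \<le> p" and r: "0 < r"
    and small: "scaled_mass v x r \<le> 1"
  shows "aux_m v x \<le> ennreal (1 / r)"
proof -
  have "ennreal (r powi (2 - int CARD('a))) * (\<integral>\<^sup>+y\<in>cube x r. ennreal (v y) \<partial>lebesgue)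
    = ennreal (scaled_mass v x r)"
    using r by (simp add: mass_eq_nn_integral[OF v p] scaled_mass_def ennreal_mult' )
  also have "\<dots> \<le> 1" using small by (simp add: ennreal_le_1)
  finally have "aux_m v x \<le> inverse (ennreal r)"
    unfolding aux_m_def using r by (intro inverse_ennreal_antimono SUP_upper) simp
  then show ?thesis using r by (simp add: inverse_ennreal inverse_eq_divide)
qed

lemma aux_m_eq_0:
  fixes v :: "real^'n \<Rightarrow> real"
  assumes v: "reverse_hoelder p K v" and p: "1 \<le> p"
    and zero: "\<And>x r. 0 < r \<Longrightarrow> (LINT y:cube x r|lebesgue. v y) = 0"
  shows "aux_m v x = 0"
proof -
  have "aux_m v x \<le> ennreal e" if "0 < e" for e
    using aux_m_le[OF v p, of "1 / e" x] that zero[of "1 / e" x] by (simp add: scaled_mass_def)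
  then show ?thesis
    by (metis ennreal_le_epsilon ennreal_0 add_0 le_zero_eq)
qed

text \<open>
  Moving the centre by at most the radius costs one doubling.
\<close>

lemma scaled_mass_shift:
  fixes x y :: "real^'n"
  assumes v: "reverse_hoelder p K v" and p: "1 \<le> p" and r: "0 < r"
    and M: "\<And>x r. 0 < r \<Longrightarrow> (LINT y:cube x (2 * r)|lebesgue. v y) \<le> M * (LINT y:cube x r|lebesgue. v y)"
    and near: "\<And>i. \<bar>x $ i - y $ i\<bar> \<le> r"
  shows "scaled_mass v x r \<le> M * scaled_mass v y r"
proof -
  have "(LINT z:cube x r|lebesgue. v z) \<le> (LINT z:cube y (2 * r)|lebesgue. v z)"
    using near by (intro mass_mono_cube[OF v p]) simp
  also have "\<dots> \<le> M * (LINT z:cube y r|lebesgue. v z)" by (rule M[OF r])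
  finally have "r powi (2 - int CARD('n)) * (LINT z:cube x r|lebesgue. v z)
      \<le> r powi (2 - int CARD('n)) * (M * (LINT z:cube y r|lebesgue. v z))"
    using r by (intro mult_left_mono) auto
  then show ?thesis by (simp add: scaled_mass_def mult_ac)
qed

text \<open>
  Compared with cubes centred at \<open>x\<close>, the scaled mass \<open>b\<close> of the dyadic cells around \<open>x\<close> changes by a
  factor \<open>M\<close> only. For the centred version \<open>a\<close>, the decay estimate read in both directions gives
  geometric growth at large scales and geometric decay at small ones. Hence \<open>b \<le> 1\<close> holds at some
  level and fails at all large levels, and a maximal level exists.
\<close>

lemma stopping_level_exists:
  fixes v :: "real^'n \<Rightarrow> real"
  assumes v: "reverse_hoelder p K v" and p: "1 < p" "real CARD('n) / 2 < p" and K: "1 \<le> K"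
    and M1: "1 \<le> M"
    and M: "\<And>x r. 0 < r \<Longrightarrow> (LINT y:cube x (2 * r)|lebesgue. v y) \<le> M * (LINT y:cube x r|lebesgue. v y)"
    and R: "0 < R" "0 < (LINT y:cube x0 R|lebesgue. v y)"
  shows "\<exists>k. scaled_mass v (cell_center k (cell_index k x)) (2 powi k) \<le> 1 \<and>
    (\<forall>j>k. 1 < scaled_mass v (cell_center j (cell_index j x)) (2 powi j))"
proof -
  define a where "a k = scaled_mass v x (2 powi k)" for k :: int
  define b where "b k = scaled_mass v (cell_center k (cell_index k x)) (2 powi k)" for k
  have ab: "a k \<le> M * b k" and ba: "b k \<le> M * a k" for k
    unfolding a_def b_def using p cell_index_center[of x _ k]
    by (intro scaled_mass_shift[OF v _ _ M]; simp add: abs_minus_commute)+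
  define g where "g = 2 powr (2 - real CARD('n) / p)"
  have "0 < 2 - real CARD('n) / p" using p by (simp add: field_simps)
  then have g: "1 < g" unfolding g_def by simp
  have decay: "g ^ m * a j \<le> 2 * K * a (j + int m)" for j m
  proof -
    have eq: "(1 / 2 ^ m) * (2::real) powi (j + int m) = 2 powi j"
      by (simp add: power_int_add)
    have "a j \<le> 2 * K * (1 / 2 ^ m) powr (2 - real CARD('n) / p) * a (j + int m)"
      using scaled_mass_decay[OF v p(1) K, of "2 powi (j + int m)" "1 / 2 ^ m" x]
      unfolding a_def eq by simp
    also have "((1::real) / 2 ^ m) powr (2 - real CARD('n) / p) = 1 / g ^ m"
      by (simp add: g_def powr_divide powr_powr mult.commute flip: powr_realpow)
    finally show ?thesis using g by (simp add: field_simps)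
  qed
  \<comment> \<open>A large enough cube around \<open>x\<close> contains the given cube of positive mass.\<close>
  obtain j0 where j0: "0 < a j0"
  proof -
    obtain m where m: "R + norm (x0 - x) < 2 ^ m"
      using real_arch_pow[of 2 "R + norm (x0 - x)"] by auto
    have "(LINT y:cube x0 R|lebesgue. v y) \<le> (LINT y:cube x (2 powi int m)|lebesgue. v y)"
    proof (intro mass_mono_cube[OF v])
      show "\<bar>x0 $ i - x $ i\<bar> \<le> 2 powi int m - R" for i
        using m component_le_norm_cart[of "x0 - x" i] by simp
    qed (use p in simp)
    with R have "0 < a (int m)" by (simp add: a_def scaled_mass_def)
    then show ?thesis by (rule that)
  qed
  obtain m1 where m1: "2 * K * M / a j0 < g ^ m1" using real_arch_pow[OF g] by auto
  have large: "1 < b j" if "j0 + int m1 \<le> j" for j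
  proof -
    define m where "m = nat (j - j0)"
    have m: "j = j0 + int m" "m1 \<le> m" using that by (auto simp: m_def)
    have "2 * K * M < g ^ m1 * a j0" using m1 j0 by (simp add: field_simps)
    also have "\<dots> \<le> g ^ m * a j0"
      using m g j0 by (intro mult_right_mono power_increasing) auto
    also have "\<dots> \<le> 2 * K * a j" using decay[of m j0] m by simp
    also have "\<dots> \<le> 2 * K * (M * b j)" using ab[of j] K by (intro mult_left_mono) auto
    finally have "(2 * K * M) * 1 < (2 * K * M) * b j" by (simp add: mult_ac)
    moreover have "0 < 2 * K * M" using K M1 by simp
    ultimately show ?thesis by (simp only: mult_less_cancel_left_pos)
  qed
  obtain m2 where m2: "M * (2 * K * a j0) < g ^ m2" using real_arch_pow[OF g] by auto
  define k0 where "k0 = j0 - int m2"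
  have small: "b k0 \<le> 1"
  proof -
    have "g ^ m2 * b k0 \<le> g ^ m2 * (M * a k0)" using ba[of k0] g by (intro mult_left_mono) auto
    also have "\<dots> = M * (g ^ m2 * a k0)" by simp
    also have "\<dots> \<le> M * (2 * K * a j0)"
      using decay[of m2 k0] M1 by (intro mult_left_mono) (auto simp: k0_def)
    also have "\<dots> < g ^ m2 * 1" using m2 by simp
    finally show ?thesis using g by (subst (asm) mult_less_cancel_left_pos) auto
  qed
  define S where "S = {k0..j0 + int m1} \<inter> {k. b k \<le> 1}"
  have "k0 \<le> j0 + int m1" using large[of k0] small by force
  then have "k0 \<in> S" using small by (simp add: S_def)
  moreover have "finite S" by (simp add: S_def)
  ultimately have max: "Max S \<in> S" "\<And>k. k \<in> S \<Longrightarrow> k \<le> Max S" by (auto intro: Max_in)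
  have "1 < b j" if "Max S < j" for j
  proof (rule ccontr)
    assume neg: "\<not> 1 < b j"
    then have "j < j0 + int m1" using large[of j] by force
    moreover have "k0 \<le> j" using max(2)[OF \<open>k0 \<in> S\<close>] that by simp
    ultimately have "j \<in> S" using neg by (simp add: S_def)
    then show False using max(2) that by force
  qed
  moreover have "b (Max S) \<le> 1" using max(1) by (simp add: S_def)
  ultimately show ?thesis unfolding b_def by blast
qed

section \<open>Estimates on stopped cells and summation\<close>

lemma reverse_hoelder_mono:
  assumes "reverse_hoelder p K v" "K \<le> L"
  shows "reverse_hoelder p L v"
proof -
  have "K * ((LINT y:cube x r|lebesgue. v y) / measure lebesgue (cube x r))
      \<le> L * ((LINT y:cube x r|lebesgue. v y) / measure lebesgue (cube x r))" for x r
    using assms mass_nonneg[OF assms(1)] by (intro mult_right_mono divide_nonneg_nonneg) auto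
  with assms(1) show ?thesis unfolding reverse_hoelder_def by (blast intro: order_trans)
qed

text \<open>
  One doubling passes from the centre \<open>c\<close> to \<open>x\<close>, and shrinking the radius to \<open>s * h\<close> with \<open>s\<close>
  small absorbs the constants, so that \<open>s * h\<close> is an admissible radius at \<open>x\<close>.
\<close>

lemma aux_m_le_stopped:
  fixes v :: "real^'n \<Rightarrow> real"
  assumes v: "reverse_hoelder p K v" and p: "1 < p" "real CARD('n) / 2 < p" and K: "1 \<le> K"
    and M1: "1 \<le> M"
    and M: "\<And>x r. 0 < r \<Longrightarrow> (LINT y:cube x (2 * r)|lebesgue. v y) \<le> M * (LINT y:cube x r|lebesgue. v y)"
    and h: "0 < h" and near: "\<And>i. \<bar>x $ i - c $ i\<bar> \<le> h" and small: "scaled_mass v c h \<le> 1"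
  shows "aux_m v x \<le> ennreal ((2 * K * M) powr (1 / (2 - real CARD('n) / p)) / h)"
proof -
  let ?\<alpha> = "2 - real CARD('n) / p"
  \<comment> \<open>Chosen so that the factor \<open>2 * K * s powr ?\<alpha> * M\<close> below equals 1.\<close>
  define s where "s = (1 / (2 * K * M)) powr (1 / ?\<alpha>)"
  have \<alpha>: "0 < ?\<alpha>" using p by (simp add: field_simps)
  have KM: "1 \<le> K * M" using mult_mono[OF K M1] K by simp
  have s: "0 < s" "s \<le> 1"
    using KM \<alpha> by (auto simp: s_def mult.assoc intro!: powr_le1)
  have "scaled_mass v x (s * h) \<le> 2 * K * s powr ?\<alpha> * scaled_mass v x h"
    by (rule scaled_mass_decay[OF v p(1) K h s])
  also have "\<dots> \<le> 2 * K * s powr ?\<alpha> * (M * scaled_mass v c h)"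
    using K p by (intro mult_left_mono scaled_mass_shift[OF v _ h M near]) auto
  also have "\<dots> \<le> 2 * K * s powr ?\<alpha> * (M * 1)"
    using K M1 small by (intro mult_left_mono) auto
  also have "s powr ?\<alpha> = 1 / (2 * K * M)"
    using KM \<alpha> by (simp add: s_def powr_powr mult.assoc)
  also have "2 * K * (1 / (2 * K * M)) * (M * 1) = 1" using K M1 by simp
  finally have "aux_m v x \<le> ennreal (1 / (s * h))"
    using s h p by (intro aux_m_le[OF v]) auto
  also have "1 / (s * h) = (2 * K * M) powr (1 / ?\<alpha>) / h"
    using KM by (simp add: s_def powr_divide mult.assoc)
  finally show ?thesis .
qed

text \<open>
  The cube around \<open>b\<close>, in the application the parent of the stopped cube, lies in the dilate of the
  stopped cube by 8. Three doublings then bound the average of \<open>v\<close> on the stopped cube from below by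
  a multiple of \<open>1 / h\<^sup>2\<close>, and \<open>v\<close> inherits this bound on a fixed fraction of the cube.
\<close>

lemma stopped_cube_energy:
  fixes u :: "real^'n \<Rightarrow> real^'d" and v :: "real^'n \<Rightarrow> real"
  assumes diff: "\<And>x. u differentiable (at x)"
    and cont: "continuous_on UNIV (\<lambda>x. jacobian u (at x))"
    and v: "reverse_hoelder p K v" and p: "1 < p" and K: "1 \<le> K" and n: "2 \<le> CARD('n)"
    and M1: "1 \<le> M"
    and M: "\<And>x r. 0 < r \<Longrightarrow> (LINT y:cube x (2 * r)|lebesgue. v y) \<le> M * (LINT y:cube x r|lebesgue. v y)"
    and h: "0 < h" and near: "\<And>i. \<bar>b $ i - c $ i\<bar> \<le> 6 * h" and big: "1 < scaled_mass v b (2 * h)"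
  defines "\<delta> \<equiv> 1 / (4 * M ^ 3 * 2 ^ CARD('n))" and "\<kappa> \<equiv> small_fraction p K"
  shows "(\<integral>\<^sup>+x\<in>cube c h. ennreal ((norm (u x))\<^sup>2 / h\<^sup>2) \<partial>lebesgue)
    \<le> ennreal (2 / (\<delta> * \<kappa>) + 8 * real CARD('n) * 2 ^ CARD('n) / \<kappa>) *
      ((\<integral>\<^sup>+x\<in>cube c h. ennreal ((norm (jacobian u (at x)))\<^sup>2) \<partial>lebesgue)
       + (\<integral>\<^sup>+x\<in>cube c h. ennreal (v x * (norm (u x))\<^sup>2) \<partial>lebesgue))"
proof -
  let ?I = "LINT y:cube c h|lebesgue. v y" and ?n = "CARD('n)"
  have "(LINT y:cube b (2 * h)|lebesgue. v y) \<le> (LINT y:cube c (2 * (2 * (2 * h)))|lebesgue. v y)"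
    using near p by (intro mass_mono_cube[OF v]) auto
  also have "\<dots> \<le> M * (M * (M * ?I))"
    using h M1 by (intro order_trans[OF M] mult_left_mono) auto
  finally have bI: "(LINT y:cube b (2 * h)|lebesgue. v y) \<le> M ^ 3 * ?I"
    by (simp add: power3_eq_cube mult.assoc)
  have pw: "(2 * h) powi (2 - int ?n) \<le> h\<^sup>2 / h ^ ?n"
  proof -
    have "(2 * h) powi (2 - int ?n) = 4 / 2 ^ ?n * (h\<^sup>2 / h ^ ?n)"
      using h by (simp add: power_int_diff power_mult_distrib)
    also have "\<dots> \<le> 1 * (h\<^sup>2 / h ^ ?n)"
      using power_increasing[OF n, of "2::real"] h by (intro mult_right_mono) auto
    finally show ?thesis by simp
  qed
  have "1 < (h\<^sup>2 / h ^ ?n) * (M ^ 3 * ?I)"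
    using big unfolding scaled_mass_def
    by (rule less_le_trans) (intro mult_mono pw bI mass_nonneg[OF v], use h in auto)
  then have low: "\<delta> / h\<^sup>2 < ?I / (4 * measure lebesgue (cube c h))"
    using h M1 by (simp add: \<delta>_def measure_cube power_mult_distrib field_simps)
  have \<delta>: "0 < \<delta>" using M1 by (simp add: \<delta>_def)
  have m: "0 < measure lebesgue (cube c h)" using h by (simp add: measure_cube)
  have I: "0 < ?I"
  proof (rule ccontr)
    assume "\<not> 0 < ?I"
    then have "?I / (4 * measure lebesgue (cube c h)) \<le> 0" using m by (simp add: divide_le_0_iff)
    moreover have "0 < \<delta> / h\<^sup>2" using \<delta> h by simp
    ultimately show False using low by linarith
  qed
  note large = reverse_hoelder_large_values[OF v p K h I]
  show ?thesis
  proof (rule local_energy_bound[OF diff cont h reverse_hoelder_nonneg[OF v]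
        reverse_hoelder_measurable[OF v] large(1) _ _ _ \<delta>])
    show "0 < \<kappa>" unfolding \<kappa>_def by (rule small_fraction_bounds(1)[OF p K])
    show "\<kappa> * measure lebesgue (cube c h) \<le> measure lebesgue
        {y \<in> cube c h. ?I / (4 * measure lebesgue (cube c h)) \<le> v y}"
      unfolding \<kappa>_def by (rule large(2))
  qed (use low in auto)
qed

text \<open>
  The integrals are decomposed over the countable set \<open>F\<close> of stopped cells. That they cover the space
  bounds the left-hand side by a sum over cells, and their disjointness bounds this sum by the right-hand
  side. If \<open>v\<close> has
  no mass at all, \<open>m\<close> vanishes and there is nothing to prove.
\<close>

lemma fefferman_phong_reverse_hoelder:
  fixes p K :: real
  assumes n: "2 \<le> CARD('n)" and p: "1 < p" "real CARD('n) / 2 < p" and K: "1 \<le> K"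
  shows "\<exists>C>0. \<forall>v :: real^'n \<Rightarrow> real. reverse_hoelder p K v \<longrightarrow>
    (\<forall>u :: real^'n \<Rightarrow> real^'d. (\<forall>x. u differentiable (at x)) \<longrightarrow>
        continuous_on UNIV (\<lambda>x. jacobian u (at x)) \<longrightarrow>
      (\<integral>\<^sup>+x. (aux_m v x * ennreal (norm (u x)))\<^sup>2 \<partial>lebesgue)
        \<le> ennreal C * ((\<integral>\<^sup>+x. ennreal ((norm (jacobian u (at x)))\<^sup>2) \<partial>lebesgue)
            + (\<integral>\<^sup>+x. ennreal (v x * (norm (u x))\<^sup>2) \<partial>lebesgue)))"
proof -
  obtain M where M1: "1 \<le> M" and dbl: "\<And>v (x::real^'n) r. reverse_hoelder p K v \<Longrightarrow> 0 < r \<Longrightarrow>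
      (LINT y:cube x (2 * r)|lebesgue. v y) \<le> M * (LINT y:cube x r|lebesgue. v y)"
    using mass_doubling[OF p(1) K, where 'n = 'n] by blast
  define B where "B = (2 * K * M) powr (1 / (2 - real CARD('n) / p))"
  define \<delta> where "\<delta> = 1 / (4 * M ^ 3 * 2 ^ CARD('n))"
  define \<kappa> where "\<kappa> = small_fraction p K"
  define C where "C = 2 / (\<delta> * \<kappa>) + 8 * real CARD('n) * 2 ^ CARD('n) / \<kappa>"
  have C: "0 < C"
    using small_fraction_bounds(1)[OF p(1) K] M1 by (auto simp: C_def \<kappa>_def \<delta>_def intro!: add_pos_pos)
  have B: "0 < B" using K M1 by (simp add: B_def)
  show ?thesis
  proof (intro exI[of _ "B\<^sup>2 * C"] conjI allI impI)
    fix v :: "real^'n \<Rightarrow> real" and u :: "real^'n \<Rightarrow> real^'d"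
    assume v: "reverse_hoelder p K v" and diff': "\<forall>x. u differentiable (at x)"
      and cont: "continuous_on UNIV (\<lambda>x. jacobian u (at x))"
    have diff: "u differentiable (at x)" for x using diff' by blast
    have "continuous_on UNIV u"
      using diff by (simp add: continuous_on_eq_continuous_at differentiable_imp_continuous_within)
    then have "u \<in> borel_measurable borel" by (rule borel_measurable_continuous_onI)
    then have [measurable]: "u \<in> borel_measurable lebesgue"
      by (intro measurable_completion) simp
    have "(\<lambda>x. jacobian u (at x)) \<in> borel_measurable borel"
      using cont by (rule borel_measurable_continuous_onI)
    then have [measurable]: "(\<lambda>x. jacobian u (at x)) \<in> borel_measurable lebesgue"
      by (intro measurable_completion) simp
    have [measurable]: "v \<in> borel_measurable lebesgue" by (rule reverse_hoelder_measurable[OF v])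
    have [measurable]: "cell k z \<in> sets lebesgue" for k and z :: "int^'n"
      using cell_sets_borel[of k z] by simp
    let ?D = "\<lambda>x. ennreal ((norm (jacobian u (at x)))\<^sup>2)"
    let ?V = "\<lambda>x. ennreal (v x * (norm (u x))\<^sup>2)"
    show "(\<integral>\<^sup>+x. (aux_m v x * ennreal (norm (u x)))\<^sup>2 \<partial>lebesgue)
        \<le> ennreal (B\<^sup>2 * C) * ((\<integral>\<^sup>+x. ?D x \<partial>lebesgue) + (\<integral>\<^sup>+x. ?V x \<partial>lebesgue))"
    proof (cases "\<forall>R>0. (LINT y:cube 0 R|lebesgue. v y) = 0")
      case True
      have "(LINT y:cube x r|lebesgue. v y) = 0" if "0 < r" for x r
      proof (rule antisym)
        have "(LINT y:cube x r|lebesgue. v y) \<le> (LINT y:cube 0 (r + norm x)|lebesgue. v y)"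
          using p component_le_norm_cart[of x] by (intro mass_mono_cube[OF v]) auto
        also have "\<dots> = 0" using True that by (simp add: add_pos_nonneg)
        finally show "(LINT y:cube x r|lebesgue. v y) \<le> 0" .
      qed (rule mass_nonneg[OF v])
      then have "aux_m v x = 0" for x
        using p by (intro aux_m_eq_0[OF v]) auto
      then show ?thesis by simp
    next
      case False
      then obtain R where R: "0 < R" "0 < (LINT y:cube 0 R|lebesgue. v y)"
        using mass_nonneg[OF v] by (metis less_le)
      define stopped where "stopped k x \<longleftrightarrow>
        scaled_mass v (cell_center k (cell_index k x)) (2 powi k) \<le> 1 \<and>
        (\<forall>j>k. 1 < scaled_mass v (cell_center j (cell_index j x)) (2 powi j))" for k x
      have ex: "\<exists>k. stopped k x" for x
        unfolding stopped_def
        by (rule stopping_level_exists[OF v p K M1 dbl[OF v] R])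
      have uniq: "j = k" if "stopped j x" "stopped k x" for j k x
        using that unfolding stopped_def by (metis linorder_neqE not_less)
      have stopped_cell: "stopped k y" if "stopped k x" "cell_index k x = cell_index k y" for k x y
        using that cell_index_coarsen[OF that(2)] unfolding stopped_def by (metis less_imp_le)
      define F where "F = {(k, cell_index k x) | k x. stopped k x}"
      have F: "countable F" by (rule countableI_type)
      let ?c = "\<lambda>q. cell (fst q) (snd q)"
      have cover: "(k, cell_index k x) \<in> F" if "stopped k x" for k x
        using that by (auto simp: F_def)
      \<comment> \<open>Sums over cells are integrals against the counting measure; disjointness says that each point is counted at most once.\<close>
      have once: "(\<integral>\<^sup>+q. indicator (?c q) x \<partial>count_space F) \<le> 1" for x
      proof -
        obtain k where k: "stopped k x" using ex by blast
        have "q = (k, cell_index k x)" if "q \<in> F" "x \<in> ?c q" for q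
        proof -
          obtain j y where q: "q = (j, cell_index j y)" "stopped j y"
            using \<open>q \<in> F\<close> by (auto simp: F_def)
          then have "cell_index j y = cell_index j x" using that(2) by (simp add: cell_def)
          then show ?thesis using stopped_cell[OF q(2)] uniq[OF k] q(1) by auto
        qed
        then have "(\<integral>\<^sup>+q. indicator (?c q) x \<partial>count_space F)
            \<le> (\<integral>\<^sup>+q. indicator {(k, cell_index k x)} q \<partial>count_space F)"
          by (intro nn_integral_mono) (auto simp: indicator_def)
        also have "\<dots> = 1"
          using cover[OF k] by (subst nn_integral_indicator) auto
        finally show ?thesis .
      qed
      have energy: "(\<integral>\<^sup>+x\<in>?c q. ennreal ((norm (u x))\<^sup>2 / (2 powi fst q)\<^sup>2) \<partial>lebesgue)
          \<le> ennreal C * (\<integral>\<^sup>+x\<in>?c q. ?D x + ?V x \<partial>lebesgue)" if "q \<in> F" for q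
      proof -
        obtain k x where q: "q = (k, cell_index k x)" and st: "stopped k x"
          using \<open>q \<in> F\<close> by (auto simp: F_def)
        let ?b = "cell_center (k + 1) (cell_index (k + 1) x)" and ?a = "cell_center k (cell_index k x)"
        have dbl2: "(2::real) powi (k + 1) = 2 * 2 powi k" by (simp add: power_int_add)
        have "1 < scaled_mass v ?b (2 * 2 powi k)"
          using st unfolding stopped_def dbl2[symmetric] by simp
        moreover have "\<bar>?b $ i - ?a $ i\<bar> \<le> 6 * 2 powi k" for i
          using cell_index_center[of x i "k + 1"] cell_index_center[of x i k]
          unfolding dbl2 by linarith
        ultimately have "(\<integral>\<^sup>+x\<in>cube ?a (2 powi k). ennreal ((norm (u x))\<^sup>2 / (2 powi k)\<^sup>2) \<partial>lebesgue)
            \<le> ennreal C * ((\<integral>\<^sup>+x\<in>cube ?a (2 powi k). ?D x \<partial>lebesgue)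
                + (\<integral>\<^sup>+x\<in>cube ?a (2 powi k). ?V x \<partial>lebesgue))"
          unfolding C_def \<delta>_def \<kappa>_def
          by (intro stopped_cube_energy[OF diff cont v p(1) K n M1 dbl[OF v]]) auto
        then show ?thesis
          unfolding q fst_conv snd_conv nn_integral_cell_eq_cube[symmetric]
          by (subst (asm) nn_integral_add[symmetric]) (auto simp: distrib_right)
      qed
      \<comment> \<open>On each cell \<open>m\<close> is replaced by a constant; the sum has one nonzero term, from the cell of \<open>x\<close>.\<close>
      have bound: "(aux_m v x * ennreal (norm (u x)))\<^sup>2
          \<le> (\<integral>\<^sup>+q. ennreal (B\<^sup>2) * (ennreal ((norm (u x))\<^sup>2 / (2 powi fst q)\<^sup>2) * indicator (?c q) x) \<partial>count_space F)"
        (is "_ \<le> integral\<^sup>N _ ?f") for x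
      proof -
        obtain k where k: "stopped k x" using ex by blast
        have "aux_m v x \<le> ennreal (B / 2 powi k)"
          unfolding B_def using k unfolding stopped_def
          by (intro aux_m_le_stopped[OF v p K M1 dbl[OF v] _ cell_index_center]) auto
        then have "(aux_m v x * ennreal (norm (u x)))\<^sup>2 \<le> (ennreal (B / 2 powi k) * ennreal (norm (u x)))\<^sup>2"
          by (intro power_mono mult_right_mono) auto
        also have "\<dots> = ?f (k, cell_index k x)"
          using B by (simp add: cell_def ennreal_mult[symmetric] ennreal_power power_mult_distrib power_divide)
        also have "\<dots> \<le> integral\<^sup>N (count_space F) ?f"
          by (rule nn_integral_ge_point[OF cover[OF k]])
        finally show ?thesis .
      qed
      have "(\<integral>\<^sup>+x. (aux_m v x * ennreal (norm (u x)))\<^sup>2 \<partial>lebesgue)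
        \<le> (\<integral>\<^sup>+x. (\<integral>\<^sup>+q. ennreal (B\<^sup>2) * (ennreal ((norm (u x))\<^sup>2 / (2 powi fst q)\<^sup>2) * indicator (?c q) x)
            \<partial>count_space F) \<partial>lebesgue)"
        by (intro nn_integral_mono bound)
      also have "\<dots> = (\<integral>\<^sup>+q. (\<integral>\<^sup>+x. ennreal (B\<^sup>2) * (ennreal ((norm (u x))\<^sup>2 / (2 powi fst q)\<^sup>2) * indicator (?c q) x)
            \<partial>lebesgue) \<partial>count_space F)"
        by (rule nn_integral_count_space_nn_integral[OF F]) measurable
      also have "\<dots> \<le> (\<integral>\<^sup>+q. ennreal (B\<^sup>2 * C) * (\<integral>\<^sup>+x\<in>?c q. ?D x + ?V x \<partial>lebesgue) \<partial>count_space F)"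
      proof (rule nn_integral_mono)
        fix q assume "q \<in> space (count_space F)"
        then have "ennreal (B\<^sup>2) * (\<integral>\<^sup>+x\<in>?c q. ennreal ((norm (u x))\<^sup>2 / (2 powi fst q)\<^sup>2) \<partial>lebesgue)
            \<le> ennreal (B\<^sup>2) * (ennreal C * (\<integral>\<^sup>+x\<in>?c q. ?D x + ?V x \<partial>lebesgue))"
          using energy[of q] by (intro mult_left_mono) auto
        then show "(\<integral>\<^sup>+x. ennreal (B\<^sup>2) * (ennreal ((norm (u x))\<^sup>2 / (2 powi fst q)\<^sup>2) * indicator (?c q) x) \<partial>lebesgue)
            \<le> ennreal (B\<^sup>2 * C) * (\<integral>\<^sup>+x\<in>?c q. ?D x + ?V x \<partial>lebesgue)"
          using C by (simp add: nn_integral_cmult ennreal_mult mult.assoc)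
      qed
      also have "\<dots> = ennreal (B\<^sup>2 * C) * (\<integral>\<^sup>+q. (\<integral>\<^sup>+x\<in>?c q. ?D x + ?V x \<partial>lebesgue) \<partial>count_space F)"
        by (rule nn_integral_cmult) simp
      also have "(\<integral>\<^sup>+q. (\<integral>\<^sup>+x\<in>?c q. ?D x + ?V x \<partial>lebesgue) \<partial>count_space F)
          = (\<integral>\<^sup>+x. (\<integral>\<^sup>+q. (?D x + ?V x) * indicator (?c q) x \<partial>count_space F) \<partial>lebesgue)"
        by (rule nn_integral_count_space_nn_integral[OF F, symmetric]) measurable
      also have "\<dots> \<le> (\<integral>\<^sup>+x. ?D x + ?V x \<partial>lebesgue)"
      proof (rule nn_integral_mono)
        fix x
        have "(\<integral>\<^sup>+q. (?D x + ?V x) * indicator (?c q) x \<partial>count_space F)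
          = (?D x + ?V x) * (\<integral>\<^sup>+q. indicator (?c q) x \<partial>count_space F)"
          by (rule nn_integral_cmult) simp
        also have "\<dots> \<le> (?D x + ?V x) * 1" by (intro mult_left_mono once) simp
        finally show "(\<integral>\<^sup>+q. (?D x + ?V x) * indicator (?c q) x \<partial>count_space F) \<le> ?D x + ?V x"
          by simp
      qed
      also have "\<dots> = (\<integral>\<^sup>+x. ?D x \<partial>lebesgue) + (\<integral>\<^sup>+x. ?V x \<partial>lebesgue)"
        by (rule nn_integral_add) measurable
      finally show ?thesis by (simp add: mult_left_mono)
    qed
  qed (use B C in simp)
qed

theorem corollary4p4:
  fixes p K :: real
  assumes "CARD('n::finite) \<ge> 3"
    and "CARD('d::finite) \<ge> 2"
    and "p > real CARD('n) / 2"
  shows "\<exists>C>0::real. \<forall>V :: real^'n \<Rightarrow> real^'d^'d.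
    matrix_weight V \<longrightarrow> reverse_hoelder p K (\<lambda>x. op_norm (V x)) \<longrightarrow>
    (\<forall>u :: real^'n \<Rightarrow> real^'d. C1_compact_support u \<longrightarrow>
      (\<integral>\<^sup>+x. (aux_m (\<lambda>y. op_norm (V y)) x * ennreal (norm (u x)))^2 \<partial>lebesgue)
        \<le> ennreal C *
           ((\<integral>\<^sup>+x. ennreal ((norm (jacobian u (at x)))^2) \<partial>lebesgue)
            + (\<integral>\<^sup>+x. ennreal (op_norm (V x) * (norm (u x))^2) \<partial>lebesgue)))"
proof -
  have "1 < p" using assms(1,3) by linarith
  moreover have "2 \<le> CARD('n)" using assms(1) by linarith
  moreover have "1 \<le> max K 1" by simp
  ultimately obtain C where "0 < C" and C: "\<And>(v :: real^'n \<Rightarrow> real) (u :: real^'n \<Rightarrow> real^'d).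
      reverse_hoelder p (max K 1) v \<Longrightarrow> \<forall>x. u differentiable (at x) \<Longrightarrow>
      continuous_on UNIV (\<lambda>x. jacobian u (at x)) \<Longrightarrow>
      (\<integral>\<^sup>+x. (aux_m v x * ennreal (norm (u x)))\<^sup>2 \<partial>lebesgue)
        \<le> ennreal C * ((\<integral>\<^sup>+x. ennreal ((norm (jacobian u (at x)))\<^sup>2) \<partial>lebesgue)
            + (\<integral>\<^sup>+x. ennreal (v x * (norm (u x))\<^sup>2) \<partial>lebesgue))"
    using fefferman_phong_reverse_hoelder[where 'n = 'n and 'd = 'd, of p "max K 1"] assms(3) by blast
  show ?thesis
  proof (intro exI[of _ C] conjI allI impI)
    fix V :: "real^'n \<Rightarrow> real^'d^'d" and u :: "real^'n \<Rightarrow> real^'d"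
    assume "reverse_hoelder p K (\<lambda>x. op_norm (V x))"       and u: "C1_compact_support u"
    from this(1) have "reverse_hoelder p (max K 1) (\<lambda>x. op_norm (V x))"
      by (rule reverse_hoelder_mono) simp
    then show "(\<integral>\<^sup>+x. (aux_m (\<lambda>y. op_norm (V y)) x * ennreal (norm (u x)))^2 \<partial>lebesgue)
        \<le> ennreal C *
           ((\<integral>\<^sup>+x. ennreal ((norm (jacobian u (at x)))^2) \<partial>lebesgue)
            + (\<integral>\<^sup>+x. ennreal (op_norm (V x) * (norm (u x))^2) \<partial>lebesgue))"
      using u unfolding C1_compact_support_def by (intro C) auto
  qed (rule \<open>0 < C\<close>)
qed

end
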